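(* Let $(M^{2m+1},A,Q,\eta,\xi,g)$ be a weak almost para-contact metric manifold, considered as a generalized Riemannian manifold $(M,G=g+F)$ with $F(X,Y)=g(AX,Y)$. Suppose that there exists a generalized metric connection $\nabla$ (i.e. a linear connection with $\nabla G=0$) whose torsion $(0,3)$-tensor $T$ is totally skew-symmetric. Then: i) The Reeb vector field $\xi$ is a geodesic and Killing vector field (i.e. $\nabla^g_\xi\xi=0$ and $g(\nabla^g_X\xi,Y)+g(\nabla^g_Y\xi,X)=0$ for all $X,Y$). ii) The connection $\nabla$ satisfies the $Q$-torsion condition $$T(QX,Y)=T(X,QY)=Q\,T(X,Y)\quad\text{for all vector fields }X,Y$$ if and only if the $(0,3)$-tensor $$N_A^{\mathrm{wapc}}:=N_A-d\eta\otimes\eta$$ (the Nijenhuis tensor in weak almost para-contact geometry) is totally skew-symmetric.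
   Context: A weak almost para-contact metric manifold $(M,A,Q,\eta,\xi,g)$ is a $(2m+1)$-dimensional pseudo-Riemannian manifold $(M,g)$ of signature $(m+1,m)$ with a $(1,1)$-tensor $A$ of rank $2m$, skew-symmetric with respect to $g$, a non-singular $(1,1)$-tensor $Q$, a vector field $\xi$ and a 1-form $\eta$ dual to $\xi$, $\eta(X)=g(X,\xi)$, $\eta(\xi)=1$, satisfying $A^2=Q-\eta\otimes\xi$, $g(AX,AY)=-g(QX,Y)+\eta(X)\eta(Y)$, $A\xi=0$, $Q\xi=\xi$. Then $F(X,Y)=g(AX,Y)$ is a 2-form of rank $2m$; $G=g+F$ has symmetric part $g$ and skew-symmetric part $F$. $\nabla^g$ denotes the Levi-Civita connection of $g$. The torsion of $\nabla$ is $T(X,Y)=\nabla_XY-\nabla_YX-[X,Y]$, and $T(X,Y,Z):=g(T(X,Y),Z)$. The condition $\nabla G=0$ is equivalent to $\nabla g=\nabla F=0$. The Nijenhuis tensor of $A$ is $N_A(X,Y)=[AX,AY]+A^2[X,Y]-A[AX,Y]-A[X,AY]$, with $N_A(X,Y,Z):=g(N_A(X,Y),Z)$. The exterior derivative of $\eta$ is normalized by $d\eta(X,Y)=(\nabla^g_X\eta)(Y)-(\nabla^g_Y\eta)(X)$, and $(d\eta\otimes\eta)(X,Y,Z)=d\eta(X,Y)\,\eta(Z)$. *)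

theory Defs
  imports "HOL-Analysis.Analysis" "HOL-Library.Function_Algebras"
begin

text \<open>Functions into a real vector space form a real vector space pointwise, so that \<open>span\<close> and
  \<open>dim\<close> are available for tangent vectors, which are functionals on functions below.\<close>

instantiation "fun" :: (type, real_vector) real_vector
begin

definition scaleR_fun :: "real \<Rightarrow> ('a \<Rightarrow> 'b) \<Rightarrow> 'a \<Rightarrow> 'b"
  where "scaleR_fun c f = (\<lambda>x. c *\<^sub>R f x)"

instance
  by standard
    (auto simp: scaleR_fun_def fun_eq_iff scaleR_add_right scaleR_add_left)

end

definition linear_on :: "'a::real_vector set \<Rightarrow> ('a \<Rightarrow> 'b::real_vector) \<Rightarrow> bool"
  where "linear_on V f \<longleftrightarrow>
    (\<forall>u\<in>V. \<forall>v\<in>V. f (u + v) = f u + f v) \<and> (\<forall>c. \<forall>u\<in>V. f (c *\<^sub>R u) = c *\<^sub>R f u)"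


section \<open>Smooth manifolds\<close>

text \<open>Intended for open sets: a map is of class \<open>C\<^sup>k\<^sup>+\<^sup>1\<close> iff it is differentiable with partial
  derivatives of class \<open>C\<^sup>k\<close>.\<close>

primrec Ck_on :: "nat \<Rightarrow> 'e::euclidean_space set \<Rightarrow> ('e \<Rightarrow> 'b::real_normed_vector) \<Rightarrow> bool"
  where
    "Ck_on 0 S f \<longleftrightarrow> continuous_on S f"
  | "Ck_on (Suc k) S f \<longleftrightarrow> (\<forall>x\<in>S. f differentiable (at x)) \<and>
       (\<forall>b\<in>Basis. Ck_on k S (\<lambda>x. frechet_derivative f (at x) b))"

definition smooth_on :: "'e::euclidean_space set \<Rightarrow> ('e \<Rightarrow> 'b::real_normed_vector) \<Rightarrow> bool"
  where "smooth_on S f \<longleftrightarrow> (\<forall>k. Ck_on k S f)"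

text \<open>The underlying space of a manifold is the whole type \<^typ>\<open>'a\<close>; a chart is a domain together with
  a coordinate map, whose values outside the domain are irrelevant. An atlas need not be maximal.\<close>

type_synonym ('a, 'e) atlas = "('a set \<times> ('a \<Rightarrow> 'e)) set"

locale smooth_manifold =
  fixes M :: "('a::{t2_space,second_countable_topology}, 'e::euclidean_space) atlas"
  assumes chart: "(U, \<phi>) \<in> M \<Longrightarrow>
      open U \<and> open (\<phi> ` U) \<and> (\<exists>\<psi>. homeomorphism U (\<phi> ` U) \<phi> \<psi>)"
    and covering: "(\<Union>(U, \<phi>)\<in>M. U) = UNIV"
    and transition: "(U, \<phi>) \<in> M \<Longrightarrow> (V, \<psi>) \<in> M \<Longrightarrow>
      smooth_on (\<phi> ` (U \<inter> V)) (\<psi> \<circ> inv_into U \<phi>)"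

definition smooth_functions :: "('a, 'e::euclidean_space) atlas \<Rightarrow> ('a \<Rightarrow> real) set"
  where "smooth_functions M =
    {f. \<forall>(U, \<phi>)\<in>M. smooth_on (\<phi> ` U) (f \<circ> inv_into U \<phi>)}"


section \<open>Tangent vectors, vector fields and tensor fields\<close>

text \<open>Tangent vectors at a point are the derivations at that point of the algebra of smooth functions.
  Derivations are total functionals here; they are set to zero on non-smooth functions so that equal
  derivations are equal as elements of the type.\<close>

type_synonym 'a tangent = "('a \<Rightarrow> real) \<Rightarrow> real"
type_synonym 'a vfield = "'a \<Rightarrow> 'a tangent"

definition tangent_space :: "('a, 'e::euclidean_space) atlas \<Rightarrow> 'a \<Rightarrow> 'a tangent set"
  where "tangent_space M p = {v.
    (\<forall>f. f \<notin> smooth_functions M \<longrightarrow> v f = 0) \<and>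
    (\<forall>f\<in>smooth_functions M. \<forall>h\<in>smooth_functions M. v (\<lambda>q. f q + h q) = v f + v h) \<and>
    (\<forall>c. \<forall>f\<in>smooth_functions M. v (\<lambda>q. c * f q) = c * v f) \<and>
    (\<forall>f\<in>smooth_functions M. \<forall>h\<in>smooth_functions M.
       v (\<lambda>q. f q * h q) = f p * v h + h p * v f)}"

definition vector_fields :: "('a, 'e::euclidean_space) atlas \<Rightarrow> 'a vfield set"
  where "vector_fields M = {X.
    (\<forall>p. X p \<in> tangent_space M p) \<and>
    (\<forall>f\<in>smooth_functions M. (\<lambda>q. X q f) \<in> smooth_functions M)}"

definition lie_bracket :: "'a vfield \<Rightarrow> 'a vfield \<Rightarrow> 'a vfield"
  where "lie_bracket X Y = (\<lambda>p f. X p (\<lambda>q. Y q f) - Y p (\<lambda>q. X q f))"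

definition one_form :: "('a, 'e::euclidean_space) atlas \<Rightarrow> ('a \<Rightarrow> 'a tangent \<Rightarrow> real) \<Rightarrow> bool"
  where "one_form M \<omega> \<longleftrightarrow> (\<forall>p. linear_on (tangent_space M p) (\<omega> p)) \<and>
    (\<forall>X\<in>vector_fields M. (\<lambda>p. \<omega> p (X p)) \<in> smooth_functions M)"

definition tensor_11 :: "('a, 'e::euclidean_space) atlas \<Rightarrow> ('a \<Rightarrow> 'a tangent \<Rightarrow> 'a tangent) \<Rightarrow> bool"
  where "tensor_11 M A \<longleftrightarrow>
    (\<forall>p. A p ` tangent_space M p \<subseteq> tangent_space M p \<and> linear_on (tangent_space M p) (A p)) \<and>
    (\<forall>X\<in>vector_fields M. (\<lambda>p. A p (X p)) \<in> vector_fields M)"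

definition tensor_02 ::
    "('a, 'e::euclidean_space) atlas \<Rightarrow> ('a \<Rightarrow> 'a tangent \<Rightarrow> 'a tangent \<Rightarrow> real) \<Rightarrow> bool"
  where "tensor_02 M B \<longleftrightarrow>
    (\<forall>p. \<forall>u\<in>tangent_space M p. linear_on (tangent_space M p) (\<lambda>v. B p u v) \<and>
       linear_on (tangent_space M p) (\<lambda>v. B p v u)) \<and>
    (\<forall>X\<in>vector_fields M. \<forall>Y\<in>vector_fields M. (\<lambda>p. B p (X p) (Y p)) \<in> smooth_functions M)"

definition app :: "('a \<Rightarrow> 'a tangent \<Rightarrow> 'a tangent) \<Rightarrow> 'a vfield \<Rightarrow> 'a vfield"
  where "app A X = (\<lambda>p. A p (X p))"

text \<open>A quantity depending on three vector fields (a (0,3)-tensor evaluated on vector fields) is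
  totally skew-symmetric; the two transpositions generate all permutations.\<close>

definition totally_skew ::
    "('a, 'e::euclidean_space) atlas \<Rightarrow> ('a vfield \<Rightarrow> 'a vfield \<Rightarrow> 'a vfield \<Rightarrow> 'a \<Rightarrow> real) \<Rightarrow> bool"
  where "totally_skew M S \<longleftrightarrow>
    (\<forall>X\<in>vector_fields M. \<forall>Y\<in>vector_fields M. \<forall>Z\<in>vector_fields M. \<forall>p.
       S Y X Z p = - S X Y Z p \<and> S X Z Y p = - S X Y Z p)"


section \<open>Pseudo-Riemannian metrics\<close>

text \<open>Signature \<open>(r, s)\<close> means \<open>r\<close> positive and \<open>s\<close> negative directions in a \<open>g\<close>-orthonormal basis;
  such a basis makes \<open>g\<close> non-degenerate.\<close>

definition has_signature ::
    "'v::real_vector set \<Rightarrow> ('v \<Rightarrow> 'v \<Rightarrow> real) \<Rightarrow> nat \<Rightarrow> nat \<Rightarrow> bool"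
  where "has_signature V b r s \<longleftrightarrow> (\<exists>e :: nat \<Rightarrow> 'v.
    e ` {..<r + s} \<subseteq> V \<and> V = span (e ` {..<r + s}) \<and>
    (\<forall>i<r + s. \<forall>j<r + s. b (e i) (e j) = (if i \<noteq> j then 0 else if i < r then 1 else - 1)))"

definition pseudo_riemannian_metric ::
    "('a, 'e::euclidean_space) atlas \<Rightarrow> nat \<Rightarrow> nat \<Rightarrow> ('a \<Rightarrow> 'a tangent \<Rightarrow> 'a tangent \<Rightarrow> real) \<Rightarrow> bool"
  where "pseudo_riemannian_metric M r s g \<longleftrightarrow> tensor_02 M g \<and>
    (\<forall>p. \<forall>u\<in>tangent_space M p. \<forall>v\<in>tangent_space M p. g p u v = g p v u) \<and>
    (\<forall>p. has_signature (tangent_space M p) (g p) r s)"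


section \<open>Linear connections\<close>

definition linear_connection ::
    "('a, 'e::euclidean_space) atlas \<Rightarrow> ('a vfield \<Rightarrow> 'a vfield \<Rightarrow> 'a vfield) \<Rightarrow> bool"
  where "linear_connection M D \<longleftrightarrow>
    (\<forall>X\<in>vector_fields M. \<forall>Y\<in>vector_fields M. D X Y \<in> vector_fields M) \<and>
    (\<forall>X\<in>vector_fields M. \<forall>X'\<in>vector_fields M. \<forall>Y\<in>vector_fields M.
       D (X + X') Y = D X Y + D X' Y) \<and>
    (\<forall>f\<in>smooth_functions M. \<forall>X\<in>vector_fields M. \<forall>Y\<in>vector_fields M.
       D (\<lambda>p. f p *\<^sub>R X p) Y = (\<lambda>p. f p *\<^sub>R D X Y p)) \<and>
    (\<forall>X\<in>vector_fields M. \<forall>Y\<in>vector_fields M. \<forall>Y'\<in>vector_fields M.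
       D X (Y + Y') = D X Y + D X Y') \<and>
    (\<forall>f\<in>smooth_functions M. \<forall>X\<in>vector_fields M. \<forall>Y\<in>vector_fields M.
       D X (\<lambda>p. f p *\<^sub>R Y p) = (\<lambda>p. X p f *\<^sub>R Y p + f p *\<^sub>R D X Y p))"

definition cov_deriv_form :: "('a vfield \<Rightarrow> 'a vfield \<Rightarrow> 'a vfield) \<Rightarrow> ('a \<Rightarrow> 'a tangent \<Rightarrow> real) \<Rightarrow>
    'a vfield \<Rightarrow> 'a vfield \<Rightarrow> 'a \<Rightarrow> real"
  where "cov_deriv_form D \<omega> X Y p = X p (\<lambda>q. \<omega> q (Y q)) - \<omega> p (D X Y p)"

definition cov_deriv_02 ::
    "('a vfield \<Rightarrow> 'a vfield \<Rightarrow> 'a vfield) \<Rightarrow> ('a \<Rightarrow> 'a tangent \<Rightarrow> 'a tangent \<Rightarrow> real) \<Rightarrow>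
     'a vfield \<Rightarrow> 'a vfield \<Rightarrow> 'a vfield \<Rightarrow> 'a \<Rightarrow> real"
  where "cov_deriv_02 D B X Y Z p =
    X p (\<lambda>q. B q (Y q) (Z q)) - B p (D X Y p) (Z p) - B p (Y p) (D X Z p)"

definition parallel_02 ::
    "('a, 'e::euclidean_space) atlas \<Rightarrow> ('a vfield \<Rightarrow> 'a vfield \<Rightarrow> 'a vfield) \<Rightarrow>
     ('a \<Rightarrow> 'a tangent \<Rightarrow> 'a tangent \<Rightarrow> real) \<Rightarrow> bool"
  where "parallel_02 M D B \<longleftrightarrow>
    (\<forall>X\<in>vector_fields M. \<forall>Y\<in>vector_fields M. \<forall>Z\<in>vector_fields M. \<forall>p.
       cov_deriv_02 D B X Y Z p = 0)"

definition torsion ::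
    "('a vfield \<Rightarrow> 'a vfield \<Rightarrow> 'a vfield) \<Rightarrow> 'a vfield \<Rightarrow> 'a vfield \<Rightarrow> 'a vfield"
  where "torsion D X Y = D X Y - D Y X - lie_bracket X Y"

definition torsion_03 ::
    "('a \<Rightarrow> 'a tangent \<Rightarrow> 'a tangent \<Rightarrow> real) \<Rightarrow> ('a vfield \<Rightarrow> 'a vfield \<Rightarrow> 'a vfield) \<Rightarrow>
     'a vfield \<Rightarrow> 'a vfield \<Rightarrow> 'a vfield \<Rightarrow> 'a \<Rightarrow> real"
  where "torsion_03 g D X Y Z p = g p (torsion D X Y p) (Z p)"

definition levi_civita_connection ::
    "('a, 'e::euclidean_space) atlas \<Rightarrow> ('a \<Rightarrow> 'a tangent \<Rightarrow> 'a tangent \<Rightarrow> real) \<Rightarrow>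
     ('a vfield \<Rightarrow> 'a vfield \<Rightarrow> 'a vfield) \<Rightarrow> bool"
  where "levi_civita_connection M g D \<longleftrightarrow> linear_connection M D \<and> parallel_02 M D g \<and>
    (\<forall>X\<in>vector_fields M. \<forall>Y\<in>vector_fields M. torsion D X Y = 0)"

text \<open>Exterior derivative of a 1-form with the normalization without the factor 1/2; \<open>D\<close> is the
  Levi-Civita connection.\<close>

definition ext_deriv :: "('a vfield \<Rightarrow> 'a vfield \<Rightarrow> 'a vfield) \<Rightarrow> ('a \<Rightarrow> 'a tangent \<Rightarrow> real) \<Rightarrow>
    'a vfield \<Rightarrow> 'a vfield \<Rightarrow> 'a \<Rightarrow> real"
  where "ext_deriv D \<omega> X Y p = cov_deriv_form D \<omega> X Y p - cov_deriv_form D \<omega> Y X p"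


section \<open>Weak almost para-contact metric manifolds\<close>

locale weak_almost_paracontact_metric_manifold = smooth_manifold M
  for M :: "('a::{t2_space,second_countable_topology}, 'e::euclidean_space) atlas" +
  fixes m :: nat
    and A Q :: "'a \<Rightarrow> 'a tangent \<Rightarrow> 'a tangent"
    and \<eta> :: "'a \<Rightarrow> 'a tangent \<Rightarrow> real"
    and \<xi> :: "'a vfield"
    and g :: "'a \<Rightarrow> 'a tangent \<Rightarrow> 'a tangent \<Rightarrow> real"
  assumes dimension: "DIM('e) = 2 * m + 1"
    and metric: "pseudo_riemannian_metric M (m + 1) m g"
    and A_tensor: "tensor_11 M A"
    and A_rank: "dim (A p ` tangent_space M p) = 2 * m"
    and A_skew: "u \<in> tangent_space M p \<Longrightarrow> v \<in> tangent_space M p \<Longrightarrow>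
      g p (A p u) v = - g p u (A p v)"
    and Q_tensor: "tensor_11 M Q"
    and Q_nonsingular: "bij_betw (Q p) (tangent_space M p) (tangent_space M p)"
    and \<xi>_field: "\<xi> \<in> vector_fields M"
    and \<eta>_form: "one_form M \<eta>"
    and \<eta>_dual: "u \<in> tangent_space M p \<Longrightarrow> \<eta> p u = g p u (\<xi> p)"
    and \<eta>_\<xi>: "\<eta> p (\<xi> p) = 1"
    and A_square: "u \<in> tangent_space M p \<Longrightarrow> A p (A p u) = Q p u - \<eta> p u *\<^sub>R \<xi> p"
    and A_compatible: "u \<in> tangent_space M p \<Longrightarrow> v \<in> tangent_space M p \<Longrightarrow>
      g p (A p u) (A p v) = - g p (Q p u) v + \<eta> p u * \<eta> p v"
    and A_\<xi>: "A p (\<xi> p) = 0"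
    and Q_\<xi>: "Q p (\<xi> p) = \<xi> p"

definition fundamental_form ::
    "('a \<Rightarrow> 'a tangent \<Rightarrow> 'a tangent) \<Rightarrow> ('a \<Rightarrow> 'a tangent \<Rightarrow> 'a tangent \<Rightarrow> real) \<Rightarrow>
     'a \<Rightarrow> 'a tangent \<Rightarrow> 'a tangent \<Rightarrow> real"
  where "fundamental_form A g p u v = g p (A p u) v"

definition generalized_metric ::
    "('a \<Rightarrow> 'a tangent \<Rightarrow> 'a tangent) \<Rightarrow> ('a \<Rightarrow> 'a tangent \<Rightarrow> 'a tangent \<Rightarrow> real) \<Rightarrow>
     'a \<Rightarrow> 'a tangent \<Rightarrow> 'a tangent \<Rightarrow> real"
  where "generalized_metric A g p u v = g p u v + fundamental_form A g p u v"

definition generalized_metric_connection ::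
    "('a, 'e::euclidean_space) atlas \<Rightarrow> ('a \<Rightarrow> 'a tangent \<Rightarrow> 'a tangent \<Rightarrow> real) \<Rightarrow>
     ('a vfield \<Rightarrow> 'a vfield \<Rightarrow> 'a vfield) \<Rightarrow> bool"
  where "generalized_metric_connection M G D \<longleftrightarrow> linear_connection M D \<and> parallel_02 M D G"

definition nijenhuis ::
    "('a \<Rightarrow> 'a tangent \<Rightarrow> 'a tangent) \<Rightarrow> 'a vfield \<Rightarrow> 'a vfield \<Rightarrow> 'a vfield"
  where "nijenhuis A X Y =
    lie_bracket (app A X) (app A Y) + app A (app A (lie_bracket X Y))
      - app A (lie_bracket (app A X) Y) - app A (lie_bracket X (app A Y))"

text \<open>Here \<open>D\<close> is the Levi-Civita connection, used only for the exterior derivative of \<open>\<eta>\<close>.\<close>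

definition nijenhuis_wapc ::
    "('a \<Rightarrow> 'a tangent \<Rightarrow> 'a tangent) \<Rightarrow> ('a \<Rightarrow> 'a tangent \<Rightarrow> real) \<Rightarrow>
     ('a \<Rightarrow> 'a tangent \<Rightarrow> 'a tangent \<Rightarrow> real) \<Rightarrow> ('a vfield \<Rightarrow> 'a vfield \<Rightarrow> 'a vfield) \<Rightarrow>
     'a vfield \<Rightarrow> 'a vfield \<Rightarrow> 'a vfield \<Rightarrow> 'a \<Rightarrow> real"
  where "nijenhuis_wapc A \<eta> g D X Y Z p =
    g p (nijenhuis A X Y p) (Z p) - ext_deriv D \<eta> X Y p * \<eta> p (Z p)"

definition Q_torsion_condition ::
    "('a, 'e::euclidean_space) atlas \<Rightarrow> ('a \<Rightarrow> 'a tangent \<Rightarrow> 'a tangent) \<Rightarrow>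
     ('a vfield \<Rightarrow> 'a vfield \<Rightarrow> 'a vfield) \<Rightarrow> bool"
  where "Q_torsion_condition M Q D \<longleftrightarrow>
    (\<forall>X\<in>vector_fields M. \<forall>Y\<in>vector_fields M.
       torsion D (app Q X) Y = torsion D X (app Q Y) \<and>
       torsion D X (app Q Y) = app Q (torsion D X Y))"

definition geodesic_field ::
    "('a vfield \<Rightarrow> 'a vfield \<Rightarrow> 'a vfield) \<Rightarrow> 'a vfield \<Rightarrow> bool"
  where "geodesic_field D X \<longleftrightarrow> D X X = 0"

definition killing_field ::
    "('a, 'e::euclidean_space) atlas \<Rightarrow> ('a \<Rightarrow> 'a tangent \<Rightarrow> 'a tangent \<Rightarrow> real) \<Rightarrow>
     ('a vfield \<Rightarrow> 'a vfield \<Rightarrow> 'a vfield) \<Rightarrow> 'a vfield \<Rightarrow> bool"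
  where "killing_field M g D V \<longleftrightarrow>
    (\<forall>X\<in>vector_fields M. \<forall>Y\<in>vector_fields M. \<forall>p.
       g p (D X V p) (Y p) + g p (D Y V p) (X p) = 0)"

end

theory Submission
  imports Defs "HOL-Computational_Algebra.Polynomial"
begin

text \<open>
  The proof expresses everything through the torsion 3-form \<open>T\<close> of the connection \<open>D\<close>.

  Since \<open>g\<close> is symmetric and \<open>F(X, Y) = g(AX, Y)\<close> is skew-symmetric, \<open>D\<close> preserves \<open>g + F\<close> only if
  it preserves both, hence also \<open>A\<close> (lemma \<open>D_A\<close>). From \<open>A\<xi> = 0\<close> and \<open>g(\<xi>, \<xi>) = 1\<close> the vector
  \<open>w = D\<^sub>X\<xi>\<close> satisfies \<open>Aw = 0\<close> and \<open>\<eta>(w) = 0\<close>, so \<open>Qw = A\<^sup>2w + \<eta>(w)\<xi> = 0\<close> and \<open>w = 0\<close>, because \<open>Q\<close>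
  is non-singular (\<open>D_xi\<close>). A metric connection with totally skew torsion differs from the
  Levi-Civita connection by half its torsion (\<open>D_eq_Dg_plus_half_torsion\<close>), so
  \<open>2 g(\<nabla>\<^sup>g\<^sub>X\<xi>, Y) = T(X, Y, \<xi>)\<close>. This is skew in \<open>X\<close> and \<open>Y\<close>, which makes \<open>\<xi>\<close> Killing and geodesic
  and identifies \<open>d\<eta>(X, Y)\<close> with \<open>T(X, Y, \<xi>)\<close>.

  For the second part, replace each Lie bracket in \<open>N\<^sub>A\<close> by \<open>[X, Y] = D\<^sub>XY - D\<^sub>YX - T(X, Y)\<close>.
  As \<open>A\<close> is parallel, all derivatives cancel. With \<open>A\<^sup>2 = Q - \<eta> \<otimes> \<xi>\<close>, the term that comes from
  \<open>\<eta> \<otimes> \<xi>\<close> is exactly \<open>d\<eta> \<otimes> \<eta>\<close>, and what remains (\<open>nijenhuis_wapc_torsion\<close>) is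
  \<open>- (T(AX, AY, Z) + T(AX, Y, AZ) + T(X, AY, AZ)) - T(X, Y, QZ)\<close>. The bracketed sum is always
  totally skew, so the question is whether \<open>T(X, Y, QZ)\<close> is, and by self-adjointness of \<open>Q\<close> that
  is the \<open>Q\<close>-torsion condition (\<open>Q_torsion_iff\<close>).

  All of this tests identities against global vector fields, while non-degeneracy of \<open>g\<close> concerns
  tangent vectors at a point. The passage between the two needs every tangent vector to be the
  value of a vector field (\<open>tangent_vector_extends\<close>). Coordinate derivations, cut off by a smooth
  bump function, give as many vector fields independent at a point as the manifold has dimensions;
  the signature of \<open>g\<close> bounds the dimension of the space of derivations by the same number, so they
  span it.
\<close>

section \<open>Calculus of smooth functions\<close>

lemma Ck_on_cong:
  assumes "open S" "\<And>x. x \<in> S \<Longrightarrow> f x = h x" "Ck_on k S f"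
  shows "Ck_on k S h"
  using assms(2,3)
proof (induction k arbitrary: f h)
  case 0
  then show ?case by (auto cong: continuous_on_cong)
next
  case (Suc k)
  have fd: "frechet_derivative f (at x) = frechet_derivative h (at x)" "h differentiable (at x)"
    if "x \<in> S" for x
  proof -
    have "(f has_derivative frechet_derivative f (at x)) (at x)"
      using Suc.prems that by (auto simp: frechet_derivative_works)
    then have "(h has_derivative frechet_derivative f (at x)) (at x)"
      using has_derivative_transform_within_open[OF _ assms(1) that] Suc.prems(1) by blast
    then show "frechet_derivative f (at x) = frechet_derivative h (at x)" "h differentiable (at x)"
      by (auto simp: frechet_derivative_at differentiable_def)
  qed
  have "Ck_on k S (\<lambda>x. frechet_derivative h (at x) b)" if "b \<in> Basis" for b
    using Suc.IH[of "\<lambda>x. frechet_derivative f (at x) b"] Suc.prems fd that by auto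
  then show ?case using fd by simp
qed

lemma Ck_on_local:
  assumes "\<And>x. x \<in> S \<Longrightarrow> \<exists>T. open T \<and> x \<in> T \<and> Ck_on k T f"
  shows "Ck_on k S f"
  using assms
proof (induction k arbitrary: f)
  case 0
  then show ?case
    by (metis Ck_on.simps(1) continuous_at_imp_continuous_on continuous_on_eq_continuous_at)
next
  case (Suc k)
  have "f differentiable at x" if "x \<in> S" for x
    using Suc.prems[OF that] by auto
  moreover have "Ck_on k S (\<lambda>x. frechet_derivative f (at x) b)" if b: "b \<in> Basis" for b
  proof (rule Suc.IH)
    fix x
    assume "x \<in> S"
    from Suc.prems[OF this] b
    show "\<exists>T. open T \<and> x \<in> T \<and> Ck_on k T (\<lambda>x. frechet_derivative f (at x) b)" by auto
  qed
  ultimately show ?case by simp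
qed

lemma Ck_on_SucD: "Ck_on (Suc k) S f \<Longrightarrow> Ck_on k S f"
proof (induction k arbitrary: f)
  case 0
  then show ?case
    by (simp add: continuous_at_imp_continuous_on differentiable_imp_continuous_within)
next
  case (Suc k)
  then show ?case unfolding Ck_on.simps(2)[of "Suc k"] Ck_on.simps(2)[of k] by blast
qed

lemma Ck_on_const: "Ck_on k S (\<lambda>x. c)"
proof (induction k arbitrary: c)
  case (Suc k)
  have "frechet_derivative (\<lambda>x. c) (at x) = (\<lambda>b. 0)" for x :: 'a
    by (rule frechet_derivative_at[symmetric]) (rule has_derivative_const)
  then show ?case using Suc by simp
qed simp

lemma Ck_on_add:
  assumes "open S" "Ck_on k S f" "Ck_on k S h"
  shows "Ck_on k S (\<lambda>x. f x + h x)"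
  using assms(2,3)
proof (induction k arbitrary: f h)
  case 0
  then show ?case by (auto intro: continuous_on_add)
next
  case (Suc k)
  have fd: "frechet_derivative (\<lambda>x. f x + h x) (at x)
      = (\<lambda>b. frechet_derivative f (at x) b + frechet_derivative h (at x) b)" if "x \<in> S" for x
    using Suc.prems that
    by (intro frechet_derivative_at[symmetric] has_derivative_add)
       (auto simp flip: frechet_derivative_works)
  have "Ck_on k S (\<lambda>x. frechet_derivative (\<lambda>x. f x + h x) (at x) b)" if "b \<in> Basis" for b
    by (rule Ck_on_cong[OF assms(1) _ Suc.IH[of "\<lambda>x. frechet_derivative f (at x) b"
          "\<lambda>x. frechet_derivative h (at x) b"]])
       (use fd Suc.prems that in auto)
  then show ?case using Suc.prems by (auto intro: differentiable_add)
qed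

lemma Ck_on_mult:
  fixes f h :: "'e::euclidean_space \<Rightarrow> real"
  assumes "open S" "Ck_on k S f" "Ck_on k S h"
  shows "Ck_on k S (\<lambda>x. f x * h x)"
  using assms(2,3)
proof (induction k arbitrary: f h)
  case 0
  then show ?case by (auto intro: continuous_on_mult)
next
  case (Suc k)
  have fd: "frechet_derivative (\<lambda>x. f x * h x) (at x)
      = (\<lambda>b. f x * frechet_derivative h (at x) b + frechet_derivative f (at x) b * h x)"
    if "x \<in> S" for x
    using Suc.prems that
    by (intro frechet_derivative_at[symmetric] has_derivative_mult)
       (auto simp flip: frechet_derivative_works)
  have "Ck_on k S (\<lambda>x. frechet_derivative (\<lambda>x. f x * h x) (at x) b)" if b: "b \<in> Basis" for b
  proof (rule Ck_on_cong[OF assms(1)])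
    show "Ck_on k S (\<lambda>x. f x * frechet_derivative h (at x) b + frechet_derivative f (at x) b * h x)"
      using Suc.prems[THEN Ck_on_SucD] Suc.prems b by (intro Ck_on_add[OF assms(1)] Suc.IH) simp_all
  qed (use fd in auto)
  then show ?case using Suc.prems by (auto intro: differentiable_mult)
qed

lemma Ck_on_sum:
  assumes "open S" "\<And>i. i \<in> I \<Longrightarrow> Ck_on k S (f i)"
  shows "Ck_on k S (\<lambda>x. \<Sum>i\<in>I. f i x)"
  using assms(2)
proof (induction I rule: infinite_finite_induct)
  case (insert i I)
  then have "Ck_on k S (\<lambda>x. f i x + (\<Sum>i\<in>I. f i x))"
    by (intro Ck_on_add[OF assms(1)]) blast+
  then show ?case using insert.hyps by simp
qed (simp_all add: Ck_on_const)

lemma Ck_on_bounded_linear: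
  assumes "open S" "bounded_linear L" "Ck_on k S f"
  shows "Ck_on k S (\<lambda>x. L (f x))"
  using assms(3)
proof (induction k arbitrary: f)
  case 0
  then show ?case using bounded_linear.continuous_on[OF assms(2)] by auto
next
  case (Suc k)
  have hd: "((\<lambda>x. L (f x)) has_derivative (\<lambda>b. L (frechet_derivative f (at x) b))) (at x)"
    if "x \<in> S" for x
    using Suc.prems that
    by (intro bounded_linear.has_derivative[OF assms(2)]) (auto simp flip: frechet_derivative_works)
  have fd: "L (frechet_derivative f (at x) b) = frechet_derivative (\<lambda>x. L (f x)) (at x) b"
    if "x \<in> S" for x b
    by (rule fun_cong[OF frechet_derivative_at[OF hd[OF that]]])
  have "Ck_on k S (\<lambda>x. frechet_derivative (\<lambda>x. L (f x)) (at x) b)" if b: "b \<in> Basis" for b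
    by (rule Ck_on_cong[OF assms(1) fd Suc.IH]) (use Suc.prems b in simp_all)
  moreover have "(\<lambda>x. L (f x)) differentiable at x" if "x \<in> S" for x
    using hd[OF that] unfolding differentiable_def by blast
  ultimately show ?case unfolding Ck_on.simps by blast
qed

text \<open>
  Induction on \<open>k\<close>: by the chain rule, the partial derivatives of the composite are sums of
  products of the components of the derivative of \<open>u\<close> with the functions \<open>\<partial>\<^sub>c f \<circ> u\<close>, to which the
  induction hypothesis applies.
\<close>

lemma Ck_on_compose:
  fixes f :: "'f::euclidean_space \<Rightarrow> real" and u :: "'e::euclidean_space \<Rightarrow> 'f"
  assumes "open S" "u ` S \<subseteq> T" "Ck_on k T f" "Ck_on k S u"
  shows "Ck_on k S (\<lambda>x. f (u x))"
  using assms(3,4)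
proof (induction k arbitrary: f)
  case 0
  then show ?case using assms(2) by (auto intro: continuous_on_compose2)
next
  case (Suc k)
  have hd: "((\<lambda>x. f (u x)) has_derivative
      (\<lambda>b. frechet_derivative f (at (u x)) (frechet_derivative u (at x) b))) (at x)"
    and lin: "linear (frechet_derivative f (at (u x)))" if "x \<in> S" for x
  proof -
    have "(f has_derivative frechet_derivative f (at (u x))) (at (u x))"
      using Suc.prems(1) assms(2) that by (auto simp: frechet_derivative_works)
    moreover have "(u has_derivative frechet_derivative u (at x)) (at x)"
      using Suc.prems(2) that by (auto simp: frechet_derivative_works)
    ultimately show "((\<lambda>x. f (u x)) has_derivative
      (\<lambda>b. frechet_derivative f (at (u x)) (frechet_derivative u (at x) b))) (at x)"
      "linear (frechet_derivative f (at (u x)))"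
      by (auto intro: has_derivative_compose has_derivative_linear)
  qed
  have "Ck_on k S (\<lambda>x. frechet_derivative (\<lambda>x. f (u x)) (at x) b)" if b: "b \<in> Basis" for b
  proof (rule Ck_on_cong[OF assms(1)])
    show "(\<Sum>c\<in>Basis. (frechet_derivative u (at x) b \<bullet> c) * frechet_derivative f (at (u x)) c)
        = frechet_derivative (\<lambda>x. f (u x)) (at x) b" if x: "x \<in> S" for x
    proof -
      have "frechet_derivative f (at (u x)) (frechet_derivative u (at x) b)
        = frechet_derivative f (at (u x)) (\<Sum>c\<in>Basis. (frechet_derivative u (at x) b \<bullet> c) *\<^sub>R c)"
        by (simp add: euclidean_representation)
      also have "\<dots> = (\<Sum>c\<in>Basis. (frechet_derivative u (at x) b \<bullet> c) * frechet_derivative f (at (u x)) c)"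
        by (simp add: linear_sum[OF lin[OF x]] linear_scale[OF lin[OF x]])
      finally show ?thesis using frechet_derivative_at[OF hd[OF x]] by metis
    qed
    have u: "Ck_on k S u" "Ck_on k S (\<lambda>x. frechet_derivative u (at x) b)"
      using Suc.prems(2) b Ck_on_SucD by auto
    show "Ck_on k S (\<lambda>x. \<Sum>c\<in>Basis.
        (frechet_derivative u (at x) b \<bullet> c) * frechet_derivative f (at (u x)) c)"
      using Suc.prems u
      by (intro Ck_on_sum Ck_on_mult Suc.IH assms(1)
          Ck_on_bounded_linear[of _ "\<lambda>v. v \<bullet> _", OF _ bounded_linear_inner_left]) auto
  qed
  moreover have "(\<lambda>x. f (u x)) differentiable at x" if "x \<in> S" for x
    using hd[OF that] unfolding differentiable_def by blast
  ultimately show ?case unfolding Ck_on.simps by blast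
qed

lemma Ck_on_ident: "Ck_on k S (\<lambda>x. x)"
proof (cases k)
  case (Suc l)
  have "frechet_derivative (\<lambda>x. x) (at x) = (\<lambda>b. b)" for x :: 'a
    by (rule frechet_derivative_at[symmetric]) (rule has_derivative_ident)
  then have "Ck_on l S (\<lambda>x. frechet_derivative (\<lambda>x. x) (at x) b)" for b :: 'a
    by (simp only: Ck_on_const)
  then show ?thesis unfolding Suc Ck_on.simps by (blast intro: differentiable_ident)
next
  case 0
  show ?thesis unfolding 0 Ck_on.simps by (rule continuous_on_id)
qed

lemma smooth_on_cong:
  "open S \<Longrightarrow> (\<And>x. x \<in> S \<Longrightarrow> f x = h x) \<Longrightarrow> smooth_on S f \<Longrightarrow> smooth_on S h"
  unfolding smooth_on_def by (intro allI, rule Ck_on_cong[of S f h]) auto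

lemma smooth_on_local:
  assumes "\<And>x. x \<in> S \<Longrightarrow> \<exists>T. open T \<and> x \<in> T \<and> smooth_on T f"
  shows "smooth_on S f"
  unfolding smooth_on_def
proof (intro allI Ck_on_local)
  fix k x
  assume "x \<in> S"
  from assms[OF this] show "\<exists>T. open T \<and> x \<in> T \<and> Ck_on k T f"
    by (auto simp: smooth_on_def)
qed

lemma smooth_on_const: "smooth_on S (\<lambda>x. c)"
  by (simp add: smooth_on_def Ck_on_const)

lemma smooth_on_ident: "smooth_on S (\<lambda>x. x)"
  by (simp add: smooth_on_def Ck_on_ident)

lemma smooth_on_add:
  "open S \<Longrightarrow> smooth_on S f \<Longrightarrow> smooth_on S h \<Longrightarrow> smooth_on S (\<lambda>x. f x + h x)"
  by (simp add: smooth_on_def Ck_on_add)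

lemma smooth_on_mult:
  fixes f h :: "'e::euclidean_space \<Rightarrow> real"
  shows "open S \<Longrightarrow> smooth_on S f \<Longrightarrow> smooth_on S h \<Longrightarrow> smooth_on S (\<lambda>x. f x * h x)"
  by (simp add: smooth_on_def Ck_on_mult)

lemma smooth_on_bounded_linear:
  "open S \<Longrightarrow> bounded_linear L \<Longrightarrow> smooth_on S f \<Longrightarrow> smooth_on S (\<lambda>x. L (f x))"
  by (simp add: smooth_on_def Ck_on_bounded_linear)

lemma smooth_on_compose:
  fixes f :: "'f::euclidean_space \<Rightarrow> real" and u :: "'e::euclidean_space \<Rightarrow> 'f"
  shows "open S \<Longrightarrow> u ` S \<subseteq> T \<Longrightarrow> smooth_on T f \<Longrightarrow> smooth_on S u \<Longrightarrow> smooth_on S (\<lambda>x. f (u x))"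
  unfolding smooth_on_def by (intro allI, rule Ck_on_compose) auto

lemma smooth_on_imp_differentiable: "smooth_on S f \<Longrightarrow> x \<in> S \<Longrightarrow> f differentiable (at x)"
  unfolding smooth_on_def by (drule spec[of _ "Suc 0"]) simp

lemma smooth_on_partial_derivative:
  "smooth_on S f \<Longrightarrow> b \<in> Basis \<Longrightarrow> smooth_on S (\<lambda>x. frechet_derivative f (at x) b)"
  unfolding smooth_on_def
proof (intro allI)
  fix k
  assume "\<forall>k. Ck_on k S f" "b \<in> Basis"
  then have "Ck_on (Suc k) S f" "b \<in> Basis" by blast+
  then show "Ck_on k S (\<lambda>x. frechet_derivative f (at x) b)" by simp
qed

section \<open>Bump functions\<close>

text \<open>
  The functions \<open>P(1/t) exp(-1/t)\<close>, extended by \<open>0\<close> to \<open>t \<le> 0\<close>. Polynomial factors are included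
  because this family, unlike the function \<open>exp(-1/t)\<close> alone, is closed under differentiation.
\<close>

definition flat :: "real poly \<Rightarrow> real \<Rightarrow> real"
  where "flat P t = (if t > 0 then poly P (inverse t) * exp (- inverse t) else 0)"

lemma flat_tendsto_0: "(flat P \<longlongrightarrow> 0) (at 0)"
proof -
  have "((\<lambda>x. \<Sum>i\<le>degree P. coeff P i * (x ^ i / exp x)) \<longlongrightarrow> (\<Sum>i\<le>degree P. coeff P i * 0)) at_top"
    by (intro tendsto_intros tendsto_power_div_exp_0)
  then have "((\<lambda>x. poly P x * exp (- x)) \<longlongrightarrow> 0) at_top"
    by (simp add: poly_altdef sum_distrib_right exp_minus divide_inverse mult.assoc)
  then have "((\<lambda>t. poly P (inverse t) * exp (- inverse t)) \<longlongrightarrow> 0) (at_right (0::real))"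
    by (rule filterlim_compose[OF _ filterlim_inverse_at_top_right])
  then have "(flat P \<longlongrightarrow> 0) (at_right 0)"
    by (rule tendsto_cong[THEN iffD1, rotated])
       (auto simp: flat_def eventually_at_filter)
  moreover have "(flat P \<longlongrightarrow> 0) (at_left 0)"
    by (rule tendsto_eventually) (auto simp: flat_def eventually_at_filter)
  ultimately show ?thesis by (simp add: filterlim_at_split)
qed

text \<open>
  With \<open>x = 1/t\<close>, the derivative of \<open>P(x) exp(-x)\<close> in \<open>t\<close> is \<open>x\<^sup>2 (P(x) - P'(x)) exp(-x)\<close>. At \<open>0\<close>, the
  difference quotient of the function for \<open>P\<close> is the function for \<open>x P\<close>, which tends to \<open>0\<close>.
\<close>

lemma flat_has_derivative:
  "(flat P has_real_derivative flat (monom 1 2 * (P - pderiv P)) t) (at t)"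
proof -
  consider "t > 0" | "t < 0" | "t = 0" by linarith
  then show ?thesis
  proof cases
    case 1
    have "((\<lambda>t. poly P (inverse t) * exp (- inverse t)) has_real_derivative
        flat (monom 1 2 * (P - pderiv P)) t) (at t)"
      using 1 by (auto intro!: derivative_eq_intros simp: flat_def poly_monom power2_eq_square
          algebra_simps)
    then show ?thesis
      by (rule has_field_derivative_transform_within_open[of _ _ _ "{0<..}"])
         (use 1 in \<open>auto simp: flat_def\<close>)
  next
    case 2
    have "((\<lambda>t. 0) has_real_derivative flat (monom 1 2 * (P - pderiv P)) t) (at t)"
      using 2 by (simp add: flat_def)
    then show ?thesis
      by (rule has_field_derivative_transform_within_open[of _ _ _ "{..<0}"])
         (use 2 in \<open>auto simp: flat_def\<close>)
  next
    case 3
    have "((\<lambda>y. (flat P y - flat P 0) / (y - 0)) \<longlongrightarrow> 0) (at 0)"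
      by (rule tendsto_cong[THEN iffD1, OF _ flat_tendsto_0[of "pCons 0 P"]])
         (auto simp: flat_def eventually_at_filter field_simps)
    then show ?thesis using 3 by (simp add: has_field_derivative_iff flat_def)
  qed
qed

lemma smooth_flat: "smooth_on S (flat P)"
proof -
  have "Ck_on k S (flat P)" for k
  proof (induction k arbitrary: P)
    case 0
    then show ?case
      by (auto intro!: continuous_at_imp_continuous_on DERIV_isCont flat_has_derivative)
  next
    case (Suc k)
    have hd: "(flat P has_derivative (\<lambda>b. flat (monom 1 2 * (P - pderiv P)) t * b)) (at t)" for t
      using flat_has_derivative[of P t] by (simp add: has_field_derivative_def)
    show ?case
      using hd Suc frechet_derivative_at[OF hd, symmetric] by (auto simp: differentiable_def)
  qed
  then show ?thesis by (simp add: smooth_on_def)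
qed

definition bump :: "'e::euclidean_space \<Rightarrow> real \<Rightarrow> 'e \<Rightarrow> real"
  where "bump a r x = flat 1 (r\<^sup>2 - (x - a) \<bullet> (x - a))"

lemma smooth_coordinate: "open S \<Longrightarrow> smooth_on S (\<lambda>x. (x - a) \<bullet> b)"
  for a :: "'e::euclidean_space"
  using smooth_on_add[OF _ smooth_on_bounded_linear[OF _ bounded_linear_inner_left smooth_on_ident]
      smooth_on_const, of S b "- (a \<bullet> b)"]
  by (simp add: inner_diff_left)

lemma smooth_bump:
  assumes "open S"
  shows "smooth_on S (bump a r)"
proof -
  \<comment> \<open>The squared distance is written in coordinates, as a sum of products of smooth functions.\<close>
  have sq: "Ck_on k S (\<lambda>x. \<Sum>b\<in>Basis. ((x - a) \<bullet> b) * ((x - a) \<bullet> b))" for k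
    using smooth_coordinate[OF assms] unfolding smooth_on_def
    by (intro Ck_on_sum Ck_on_mult assms) auto
  have "smooth_on S (\<lambda>x. - (\<Sum>b\<in>Basis. ((x - a) \<bullet> b) * ((x - a) \<bullet> b)))"
    by (rule smooth_on_bounded_linear[OF assms bounded_linear_minus[OF bounded_linear_ident]])
       (simp add: smooth_on_def sq)
  from smooth_on_add[OF assms smooth_on_const this, of "r\<^sup>2"]
  have "smooth_on S (\<lambda>x. r\<^sup>2 - (x - a) \<bullet> (x - a))"
    by (simp add: euclidean_inner[of "x - a" "x - a" for x, symmetric])
  from smooth_on_compose[OF assms _ smooth_flat[of UNIV 1] this]
  show ?thesis by (simp add: bump_def[abs_def])
qed

lemma bump_center: "r > 0 \<Longrightarrow> bump a r a > 0"
  by (simp add: bump_def flat_def)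

lemma bump_outside: "r > 0 \<Longrightarrow> x \<notin> cball a r \<Longrightarrow> bump a r x = 0"
proof -
  assume r: "r > 0" and "x \<notin> cball a r"
  then have "r < norm (x - a)" by (simp add: dist_norm norm_minus_commute)
  then have "r\<^sup>2 < (norm (x - a))\<^sup>2" using r by (intro power_strict_mono) auto
  then show ?thesis by (simp add: bump_def flat_def power2_norm_eq_inner)
qed

section \<open>Linear algebra of bilinear forms with a signature\<close>

lemma sum_fun_apply: "(\<Sum>i\<in>I. h i) x = (\<Sum>i\<in>I. h i x)"
  for h :: "'i \<Rightarrow> 'a \<Rightarrow> 'b::comm_monoid_add"
  by (induction I rule: infinite_finite_induct) auto

lemma linear_on_sum:
  assumes "subspace V" "linear_on V f" "finite I" "\<And>i. i \<in> I \<Longrightarrow> w i \<in> V"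
  shows "f (\<Sum>i\<in>I. c i *\<^sub>R w i) = (\<Sum>i\<in>I. c i *\<^sub>R f (w i))"
  using assms(3,4)
proof (induction I)
  case empty
  have "f (0 *\<^sub>R 0) = 0 *\<^sub>R f 0"
    using assms(1,2) subspace_0 unfolding linear_on_def by blast
  then show ?case by simp
next
  case (insert i I)
  have "(\<Sum>i\<in>I. c i *\<^sub>R w i) \<in> V" "c i *\<^sub>R w i \<in> V"
    using assms(1) insert.prems by (auto intro!: subspace_sum subspace_scale)
  then show ?case using insert assms(2) by (simp add: linear_on_def)
qed

text \<open>
  Pairing \<open>u\<close> with a vector of the orthonormal basis gives its coefficient up to sign.
\<close>

lemma has_signature_nondegenerate:
  assumes sig: "has_signature V b r s" and V: "subspace V"
    and lin: "\<And>v. v \<in> V \<Longrightarrow> linear_on V (\<lambda>u. b u v)"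
    and u: "u \<in> V" "\<And>v. v \<in> V \<Longrightarrow> b u v = 0"
  shows "u = 0"
proof -
  obtain e where e: "e ` {..<r + s} \<subseteq> V" "V = span (e ` {..<r + s})"
    and b: "\<And>i j. i < r + s \<Longrightarrow> j < r + s \<Longrightarrow>
      b (e i) (e j) = (if i \<noteq> j then 0 else if i < r then 1 else - 1)"
    using sig unfolding has_signature_def by blast
  have inj: "inj_on e {..<r + s}"
  proof (rule inj_onI)
    fix i j
    assume ij: "i \<in> {..<r + s}" "j \<in> {..<r + s}" "e i = e j"
    show "i = j"
    proof (rule ccontr)
      assume "i \<noteq> j"
      then have "b (e j) (e j) = 0" using b[of i j] ij by simp
      moreover have "b (e j) (e j) \<noteq> 0" using b[of j j] ij(2) by simp
      ultimately show False by contradiction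
    qed
  qed
  obtain c where "u = (\<Sum>w\<in>e ` {..<r + s}. c w *\<^sub>R w)"
    using u(1) e(2) span_finite[of "e ` {..<r + s}"] by auto
  then have uc: "u = (\<Sum>i<r + s. c (e i) *\<^sub>R e i)"
    using sum.reindex[OF inj] by (simp add: o_def)
  have "c (e j) = 0" if j: "j < r + s" for j
  proof -
    have "0 = b u (e j)" using u(2) e(1) j by auto
    also have "\<dots> = (\<Sum>i<r + s. c (e i) *\<^sub>R b (e i) (e j))"
      unfolding uc by (rule linear_on_sum[OF V lin]) (use e(1) j in auto)
    also have "\<dots> = (\<Sum>i<r + s. if i = j then c (e j) * b (e j) (e j) else 0)"
      by (rule sum.cong) (use b j in auto)
    also have "\<dots> = c (e j) * b (e j) (e j)" using j by simp
    finally have "c (e j) * b (e j) (e j) = 0" by simp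
    moreover have "b (e j) (e j) \<noteq> 0" using b[OF j j] by simp
    ultimately show ?thesis by simp
  qed
  then show ?thesis using uc by simp
qed

section \<open>Functions, tangent vectors and vector fields on a manifold\<close>

context smooth_manifold
begin

lemma chart_homeomorphism:
  assumes "(U, \<phi>) \<in> M"
  shows "open U" "open (\<phi> ` U)" "inj_on \<phi> U"
    "continuous_on (\<phi> ` U) (inv_into U \<phi>)"
proof -
  obtain \<psi> where h: "homeomorphism U (\<phi> ` U) \<phi> \<psi>" using chart[OF assms] by blast
  show "open U" "open (\<phi> ` U)" using chart[OF assms] by auto
  show inj: "inj_on \<phi> U" by (rule inj_on_inverseI[of _ \<psi>]) (rule homeomorphism_apply1[OF h])
  have "inv_into U \<phi> x = \<psi> x" if "x \<in> \<phi> ` U" for x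
    using that inj homeomorphism_apply1[OF h] by auto
  then show "continuous_on (\<phi> ` U) (inv_into U \<phi>)"
    using homeomorphism_cont2[OF h] continuous_on_cong[OF refl, of "\<phi> ` U" "inv_into U \<phi>" \<psi>] by blast
qed

lemma open_chart_image:
  assumes "(U, \<phi>) \<in> M" "open W" "W \<subseteq> U"
  shows "open (\<phi> ` W)"
proof -
  have "\<phi> ` W = inv_into U \<phi> -` W \<inter> \<phi> ` U"
  proof (intro subset_antisym subsetI)
    fix x
    assume "x \<in> \<phi> ` W"
    then show "x \<in> inv_into U \<phi> -` W \<inter> \<phi> ` U"
      using assms(3) chart_homeomorphism(3)[OF assms(1)] by auto
  next
    fix x
    assume "x \<in> inv_into U \<phi> -` W \<inter> \<phi> ` U"
    then show "x \<in> \<phi> ` W" by (metis IntD1 IntD2 f_inv_into_f image_eqI vimageE)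
  qed
  then show ?thesis
    using continuous_open_preimage[OF chart_homeomorphism(4)[OF assms(1)] chart_homeomorphism(2)[OF assms(1)] assms(2)]
    by (simp add: Int_commute)
qed

lemma smooth_functions_iff:
  "f \<in> smooth_functions M \<longleftrightarrow>
    (\<forall>U \<phi>. (U, \<phi>) \<in> M \<longrightarrow> smooth_on (\<phi> ` U) (\<lambda>x. f (inv_into U \<phi> x)))"
  by (auto simp: smooth_functions_def o_def)

lemma smooth_functions_const: "(\<lambda>q. c) \<in> smooth_functions M"
  by (simp add: smooth_functions_iff smooth_on_const)

lemma smooth_functions_add:
  "f \<in> smooth_functions M \<Longrightarrow> h \<in> smooth_functions M \<Longrightarrow> (\<lambda>q. f q + h q) \<in> smooth_functions M"
  by (simp add: smooth_functions_iff smooth_on_add chart_homeomorphism(2))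

lemma smooth_functions_mult:
  "f \<in> smooth_functions M \<Longrightarrow> h \<in> smooth_functions M \<Longrightarrow> (\<lambda>q. f q * h q) \<in> smooth_functions M"
  by (simp add: smooth_functions_iff smooth_on_mult chart_homeomorphism(2))

lemma smooth_functions_diff:
  "f \<in> smooth_functions M \<Longrightarrow> h \<in> smooth_functions M \<Longrightarrow> (\<lambda>q. f q - h q) \<in> smooth_functions M"
  using smooth_functions_add[OF _ smooth_functions_mult[OF smooth_functions_const[of "-1"]], of f h]
  by simp

text \<open>
  Near a point of \<open>U\<close> the extended function is \<open>h\<close> composed with a transition map. A point outside
  \<open>U\<close> has a neighbourhood on which it vanishes: the preimage of the ball is compact, hence closed
  because the manifold is Hausdorff, and it lies in \<open>U\<close>.
\<close>

lemma extend_by_zero_smooth: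
  assumes M: "(U, \<phi>) \<in> M" and h: "smooth_on (\<phi> ` U) h"
    and K: "cball a r \<subseteq> \<phi> ` U" "\<And>x. x \<notin> cball a r \<Longrightarrow> h x = 0"
  shows "(\<lambda>q. if q \<in> U then h (\<phi> q) else 0) \<in> smooth_functions M" (is "?F \<in> _")
  unfolding smooth_functions_iff
proof (intro allI impI smooth_on_local)
  fix V \<psi> y
  assume N: "(V, \<psi>) \<in> M" and "y \<in> \<psi> ` V"
  then obtain q where q: "q \<in> V" "y = \<psi> q" by blast
  note injV = chart_homeomorphism(3)[OF N]
  show "\<exists>T. open T \<and> y \<in> T \<and> smooth_on T (\<lambda>x. ?F (inv_into V \<psi> x))"
  proof (cases "q \<in> U")
    case True
    let ?T = "\<psi> ` (V \<inter> U)"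
    have T: "open ?T"
      using open_chart_image[OF N, of "V \<inter> U"] chart_homeomorphism(1)[OF N]
        chart_homeomorphism(1)[OF M] by auto
    have "smooth_on ?T (\<lambda>x. h (\<phi> (inv_into V \<psi> x)))"
      by (rule smooth_on_compose[OF T _ h])
         (use transition[OF N M] injV in \<open>auto simp: o_def\<close>)
    then have "smooth_on ?T (\<lambda>x. ?F (inv_into V \<psi> x))"
      by (rule smooth_on_cong[OF T, rotated]) (use injV in auto)
    then show ?thesis using T q True by blast
  next
    case False
    define K where "K = inv_into U \<phi> ` cball a r"
    have "compact K"
      unfolding K_def using chart_homeomorphism(4)[OF M] \<open>cball a r \<subseteq> \<phi> ` U\<close>
      by (intro compact_continuous_image compact_cball) (auto intro: continuous_on_subset)
    then have "closed K" by (rule compact_imp_closed)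
    have "K \<subseteq> U" unfolding K_def using \<open>cball a r \<subseteq> \<phi> ` U\<close> by (auto intro: inv_into_into)
    let ?T = "\<psi> ` (V - K)"
    have T: "open ?T"
      using open_chart_image[OF N, of "V - K"] chart_homeomorphism(1)[OF N] \<open>closed K\<close> by auto
    have "h (\<phi> q') = 0" if "q' \<notin> K" "q' \<in> U" for q'
    proof (rule K(2))
      show "\<phi> q' \<notin> cball a r"
        using that chart_homeomorphism(3)[OF M] unfolding K_def
        by (metis image_eqI inv_into_f_f)
    qed
    then have "smooth_on ?T (\<lambda>x. ?F (inv_into V \<psi> x))"
      by (intro smooth_on_cong[OF T _ smooth_on_const[of _ 0]]) (use injV in auto)
    then show ?thesis using T q False \<open>K \<subseteq> U\<close> by blast
  qed
qed

lemma tangent_spaceD: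
  assumes "v \<in> tangent_space M p"
  shows "f \<notin> smooth_functions M \<Longrightarrow> v f = 0"
    "f \<in> smooth_functions M \<Longrightarrow> h \<in> smooth_functions M \<Longrightarrow> v (\<lambda>q. f q + h q) = v f + v h"
    "f \<in> smooth_functions M \<Longrightarrow> v (\<lambda>q. c * f q) = c * v f"
    "f \<in> smooth_functions M \<Longrightarrow> h \<in> smooth_functions M \<Longrightarrow>
      v (\<lambda>q. f q * h q) = f p * v h + h p * v f"
  using assms by (simp_all add: tangent_space_def)

lemma tangent_diff:
  assumes v: "v \<in> tangent_space M p" and f: "f \<in> smooth_functions M" "h \<in> smooth_functions M"
  shows "v (\<lambda>q. f q - h q) = v f - v h"
  using tangent_spaceD(2)[OF v f(1) smooth_functions_mult[OF smooth_functions_const[of "-1"] f(2)]]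
    tangent_spaceD(3)[OF v f(2), of "-1"] by simp

lemma tangent_const:
  assumes v: "v \<in> tangent_space M p"
  shows "v (\<lambda>q. c) = 0"
proof -
  have "v (\<lambda>q. 1 * 1) = 1 * v (\<lambda>q. 1) + 1 * v (\<lambda>q. 1)"
    by (rule tangent_spaceD(4)[OF v]) (rule smooth_functions_const)+
  then have "v (\<lambda>q. 1) = 0" by simp
  then show ?thesis using tangent_spaceD(3)[OF v smooth_functions_const[of 1], of c] by simp
qed

lemma subspace_tangent_space: "subspace (tangent_space M p)"
  unfolding subspace_def
proof (intro conjI ballI allI)
  show "0 \<in> tangent_space M p" by (simp add: tangent_space_def)
  show "u + v \<in> tangent_space M p" if "u \<in> tangent_space M p" "v \<in> tangent_space M p" for u v
    using that by (simp add: tangent_space_def algebra_simps)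
  show "c *\<^sub>R u \<in> tangent_space M p" if "u \<in> tangent_space M p" for c u
    using that by (simp add: tangent_space_def scaleR_fun_def algebra_simps)
qed

lemma linear_on_tangent_diff:
  assumes f: "linear_on (tangent_space M p) f"
    and uv: "u \<in> tangent_space M p" "v \<in> tangent_space M p"
  shows "f (u - v) = f u - f v"
proof -
  have "f (u - v) + f v = f (u - v + v)"
    using f uv subspace_diff[OF subspace_tangent_space uv] unfolding linear_on_def by metis
  then show ?thesis by (simp add: algebra_simps)
qed

lemma linear_on_tangent_0: "linear_on (tangent_space M p) f \<Longrightarrow> f 0 = 0"
  using linear_on_tangent_diff[of p f 0 0] subspace_0[OF subspace_tangent_space] by simp

lemma linear_on_tangent_add:
  "linear_on (tangent_space M p) f \<Longrightarrow> u \<in> tangent_space M p \<Longrightarrow> v \<in> tangent_space M p \<Longrightarrow>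
    f (u + v) = f u + f v"
  by (simp add: linear_on_def)

lemma linear_on_tangent_scale:
  "linear_on (tangent_space M p) f \<Longrightarrow> u \<in> tangent_space M p \<Longrightarrow> f (c *\<^sub>R u) = c *\<^sub>R f u"
  by (simp add: linear_on_def)

lemma vector_fieldsD:
  assumes "X \<in> vector_fields M"
  shows "X p \<in> tangent_space M p"
    "f \<in> smooth_functions M \<Longrightarrow> (\<lambda>q. X q f) \<in> smooth_functions M"
  using assms by (auto simp: vector_fields_def)

lemma vector_fields_add:
  assumes "X \<in> vector_fields M" "Y \<in> vector_fields M"
  shows "X + Y \<in> vector_fields M"
  using assms subspace_add[OF subspace_tangent_space] smooth_functions_add
  by (auto simp: vector_fields_def)

lemma vector_fields_diff:
  assumes "X \<in> vector_fields M" "Y \<in> vector_fields M"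
  shows "X - Y \<in> vector_fields M"
  using assms subspace_diff[OF subspace_tangent_space] smooth_functions_diff
  by (auto simp: vector_fields_def fun_diff_def)

lemma vector_fields_scale:
  assumes f: "f \<in> smooth_functions M" and X: "X \<in> vector_fields M"
  shows "(\<lambda>p. f p *\<^sub>R X p) \<in> vector_fields M"
  using assms subspace_scale[OF subspace_tangent_space] smooth_functions_mult
  by (auto simp: vector_fields_def scaleR_fun_def)

lemma vector_fields_zero: "(\<lambda>p. 0) \<in> vector_fields M"
  using subspace_0[OF subspace_tangent_space] smooth_functions_const
  by (auto simp: vector_fields_def)

lemma vector_fields_lie_bracket:
  assumes X: "X \<in> vector_fields M" and Y: "Y \<in> vector_fields M"
  shows "lie_bracket X Y \<in> vector_fields M"
proof -
  note XD = tangent_spaceD[OF vector_fieldsD(1)[OF X]] and YD = tangent_spaceD[OF vector_fieldsD(1)[OF Y]]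
  note XS = vector_fieldsD(2)[OF X] and YS = vector_fieldsD(2)[OF Y]
  have "lie_bracket X Y p \<in> tangent_space M p" for p
    unfolding tangent_space_def mem_Collect_eq
  proof (intro conjI allI ballI impI)
    fix f
    assume f: "f \<notin> smooth_functions M"
    have "(\<lambda>q. Y q f) = (\<lambda>q. 0)" "(\<lambda>q. X q f) = (\<lambda>q. 0)" using XD(1) YD(1) f by auto
    then show "lie_bracket X Y p f = 0"
      using tangent_const[OF vector_fieldsD(1)[OF X]] tangent_const[OF vector_fieldsD(1)[OF Y]]
      by (simp add: lie_bracket_def)
  next
    fix f h
    assume fh: "f \<in> smooth_functions M" "h \<in> smooth_functions M"
    show "lie_bracket X Y p (\<lambda>q. f q + h q) = lie_bracket X Y p f + lie_bracket X Y p h"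
      using fh by (simp add: lie_bracket_def XD(2) YD(2) XS YS)
    show "lie_bracket X Y p (\<lambda>q. f q * h q) = f p * lie_bracket X Y p h + h p * lie_bracket X Y p f"
      using fh
      by (simp add: lie_bracket_def XD(2,4) YD(2,4) XS YS smooth_functions_mult algebra_simps)
  next
    fix c f
    assume "f \<in> smooth_functions M"
    then show "lie_bracket X Y p (\<lambda>q. c * f q) = c * lie_bracket X Y p f"
      by (simp add: lie_bracket_def XD(3) YD(3) XS YS algebra_simps)
  qed
  moreover have "(\<lambda>q. lie_bracket X Y q f) \<in> smooth_functions M" if "f \<in> smooth_functions M" for f
    unfolding lie_bracket_def using that XS YS by (intro smooth_functions_diff) auto
  ultimately show ?thesis by (simp add: vector_fields_def)
qed

end

section \<open>Extending tangent vectors to vector fields\<close>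

context smooth_manifold
begin

text \<open>
  The partial derivative \<open>\<partial>\<^sub>b\<close> of a chart, multiplied by a bump function: if the ball of radius \<open>r\<close>
  about \<open>a\<close> lies in the image of the chart, extension by zero gives a smooth field. The test for smoothness keeps the functional zero on the other
  functions, as membership in \<^const>\<open>tangent_space\<close> demands.
\<close>

definition coordinate_field :: "'a set \<Rightarrow> ('a \<Rightarrow> 'e) \<Rightarrow> 'e \<Rightarrow> real \<Rightarrow> 'e \<Rightarrow> 'a vfield"
  where "coordinate_field U \<phi> a r b = (\<lambda>q f.
    if f \<in> smooth_functions M \<and> q \<in> U
    then bump a r (\<phi> q) * frechet_derivative (\<lambda>x. f (inv_into U \<phi> x)) (at (\<phi> q)) b
    else 0)"

lemma coordinate_field_vector_field:
  assumes M: "(U, \<phi>) \<in> M" and r: "r > 0" "cball a r \<subseteq> \<phi> ` U" and b: "b \<in> Basis"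
  shows "coordinate_field U \<phi> a r b \<in> vector_fields M"
proof -
  note [simp] = chart_homeomorphism(3)[OF M]
  have df: "((\<lambda>x. f (inv_into U \<phi> x)) has_derivative
      frechet_derivative (\<lambda>x. f (inv_into U \<phi> x)) (at (\<phi> q))) (at (\<phi> q))"
    if "f \<in> smooth_functions M" "q \<in> U" for f q
  proof -
    have "(\<lambda>x. f (inv_into U \<phi> x)) differentiable (at (\<phi> q))"
      by (rule smooth_on_imp_differentiable[of "\<phi> ` U"])
         (use that M in \<open>auto simp: smooth_functions_iff\<close>)
    then show ?thesis by (simp add: frechet_derivative_works)
  qed
  have "coordinate_field U \<phi> a r b p \<in> tangent_space M p" for p
    unfolding tangent_space_def mem_Collect_eq
  proof (intro conjI allI ballI impI)
    fix f h
    assume fh: "f \<in> smooth_functions M" "h \<in> smooth_functions M"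
    show "coordinate_field U \<phi> a r b p (\<lambda>q. f q + h q)
        = coordinate_field U \<phi> a r b p f + coordinate_field U \<phi> a r b p h"
      using fh frechet_derivative_at[OF has_derivative_add[OF df[OF fh(1)] df[OF fh(2)]], symmetric]
      by (simp add: coordinate_field_def smooth_functions_add algebra_simps)
    show "coordinate_field U \<phi> a r b p (\<lambda>q. f q * h q)
        = f p * coordinate_field U \<phi> a r b p h + h p * coordinate_field U \<phi> a r b p f"
      using fh frechet_derivative_at[OF has_derivative_mult[OF df[OF fh(1)] df[OF fh(2)]], symmetric]
      by (simp add: coordinate_field_def smooth_functions_mult algebra_simps)
  next
    fix c f
    assume f: "f \<in> smooth_functions M"
    show "coordinate_field U \<phi> a r b p (\<lambda>q. c * f q) = c * coordinate_field U \<phi> a r b p f"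
      using f frechet_derivative_at[OF has_derivative_mult_right[OF df[OF f], of _ c], symmetric]
      by (simp add: coordinate_field_def smooth_functions_mult smooth_functions_const)
  qed (simp add: coordinate_field_def)
  moreover have "(\<lambda>q. coordinate_field U \<phi> a r b q f) \<in> smooth_functions M"
    if f: "f \<in> smooth_functions M" for f
  proof -
    let ?h = "\<lambda>x. bump a r x * frechet_derivative (\<lambda>x. f (inv_into U \<phi> x)) (at x) b"
    have "smooth_on (\<phi> ` U) ?h"
      using f M b chart_homeomorphism(2)[OF M]
      by (intro smooth_on_mult smooth_bump smooth_on_partial_derivative)
         (auto simp: smooth_functions_iff)
    from extend_by_zero_smooth[OF M this r(2)] r(1)
    have "(\<lambda>q. if q \<in> U then ?h (\<phi> q) else 0) \<in> smooth_functions M"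
      by (simp add: bump_outside)
    then show ?thesis using f by (simp add: coordinate_field_def)
  qed
  ultimately show ?thesis by (simp add: vector_fields_def)
qed

text \<open>
  The functions \<open>F c\<close> are the centred coordinates multiplied by the bump function. They vanish at
  \<open>p\<close>, so that the derivative of the bump function does not contribute there, and \<open>k\<close> is the square
  of the bump at its centre: one factor from the field, one from the function.
\<close>

lemma dual_functions_exist:
  "\<exists>(E :: 'e \<Rightarrow> 'a vfield) (F :: 'e \<Rightarrow> 'a \<Rightarrow> real) k. k \<noteq> 0 \<and>
    (\<forall>b\<in>Basis. E b \<in> vector_fields M \<and> (\<forall>c\<in>Basis. E b p (F c) = (if b = c then k else 0)))"
proof -
  have "p \<in> (\<Union>(U, \<phi>)\<in>M. U)" by (simp only: covering UNIV_I)
  then obtain U \<phi> where M: "(U, \<phi>) \<in> M" and p: "p \<in> U" by auto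
  note inj = chart_homeomorphism(3)[OF M] and op = chart_homeomorphism(2)[OF M]
  define a where "a = \<phi> p"
  obtain r where r: "r > 0" "cball a r \<subseteq> \<phi> ` U"
    using open_contains_cball[THEN iffD1, OF op, rule_format, of a] p by (auto simp: a_def)
  let ?t = "\<lambda>c x. bump a r x * ((x - a) \<bullet> c)"
  define F where "F c = (\<lambda>q. if q \<in> U then ?t c (\<phi> q) else 0)" for c
  have F: "F c \<in> smooth_functions M" for c
    unfolding F_def
    by (rule extend_by_zero_smooth[OF M _ r(2)])
       (use r op in \<open>auto intro!: smooth_on_mult smooth_bump smooth_coordinate simp: bump_outside\<close>)
  have "coordinate_field U \<phi> a r b p (F c) = (if b = c then (bump a r a)\<^sup>2 else 0)"
    if bc: "b \<in> Basis" "c \<in> Basis" for b c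
  proof -
    have "(bump a r has_derivative frechet_derivative (bump a r) (at a)) (at a)"
      using smooth_on_imp_differentiable[OF smooth_bump[OF open_UNIV], of a a r]
      by (simp add: frechet_derivative_works)
    moreover have "((\<lambda>x. (x - a) \<bullet> c) has_derivative (\<lambda>v. v \<bullet> c)) (at a)"
      by (auto intro!: derivative_eq_intros)
    ultimately have "(?t c has_derivative (\<lambda>v. bump a r a * (v \<bullet> c)
        + frechet_derivative (bump a r) (at a) v * ((a - a) \<bullet> c))) (at a)"
      by (rule has_derivative_mult)
    then have "((\<lambda>x. F c (inv_into U \<phi> x)) has_derivative (\<lambda>v. bump a r a * (v \<bullet> c))) (at a)"
      by (rule has_derivative_transform_within_open[OF _ op, THEN has_derivative_eq_rhs])
         (use p inj in \<open>auto simp: F_def a_def inv_into_into f_inv_into_f\<close>)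
    from frechet_derivative_at[OF this, symmetric]
    show ?thesis using F p bc
      by (simp add: coordinate_field_def inner_Basis power2_eq_square flip: a_def)
  qed
  moreover have "(bump a r a)\<^sup>2 \<noteq> 0" using bump_center[OF r(1), of a] by simp
  ultimately show ?thesis
    using coordinate_field_vector_field[OF M r]
    by (intro exI[of _ "coordinate_field U \<phi> a r"] exI[of _ F] exI[of _ "(bump a r a)\<^sup>2"]) simp
qed

text \<open>
  The coordinate fields are independent at \<open>p\<close>, being dual to functions. By the signature, the tangent
  space is spanned by \<open>r + s\<close> vectors, no more than there are coordinate fields, so these span it too.
\<close>

lemma tangent_vector_extends:
  assumes sig: "has_signature (tangent_space M p) b r s" and dim: "r + s = DIM('e)"
    and v: "v \<in> tangent_space M p"
  obtains X where "X \<in> vector_fields M" "X p = v"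
proof -
  obtain E :: "'e \<Rightarrow> 'a vfield" and F :: "'e \<Rightarrow> 'a \<Rightarrow> real" and k :: real
    where k: "k \<noteq> 0" and EF: "\<forall>b\<in>Basis. E b \<in> vector_fields M \<and>
      (\<forall>c\<in>Basis. E b p (F c) = (if b = c then k else 0))"
    using dual_functions_exist[of p] by (elim exE conjE) (rule that)
  have E: "E b \<in> vector_fields M" and F: "c \<in> Basis \<Longrightarrow> E b p (F c) = (if b = c then k else 0)"
    if "b \<in> Basis" for b c
    using EF that by auto
  define B where "B = (\<lambda>b. E b p) ` Basis"
  have inj: "inj_on (\<lambda>b. E b p) Basis"
  proof (rule inj_onI)
    fix b c :: 'e
    assume "b \<in> Basis" "c \<in> Basis" "E b p = E c p"
    then show "b = c" using k F[of b b] F[of c b] by (cases "c = b") simp_all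
  qed
  have ind: "independent B"
  proof -
    have "u w = 0" if u: "(\<Sum>v\<in>B. u v *\<^sub>R v) = 0" and w: "w \<in> B" for u w
    proof -
      obtain c where c: "c \<in> Basis" "w = E c p" using w B_def by blast
      have "0 = (\<Sum>v\<in>B. u v *\<^sub>R v) (F c)" using u by simp
      also have "\<dots> = (\<Sum>b\<in>Basis. u (E b p) * E b p (F c))"
        unfolding B_def by (simp add: sum_fun_apply scaleR_fun_def sum.reindex[OF inj])
      also have "\<dots> = (\<Sum>b\<in>Basis. if b = c then u w * k else 0)"
        by (rule sum.cong) (use c F in auto)
      also have "\<dots> = u w * k" using c by simp
      finally show ?thesis using k by simp
    qed
    then show ?thesis by (subst dependent_finite) (auto simp: B_def)
  qed
  obtain e where e: "tangent_space M p = span (e ` {..<r + s})"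
    using sig unfolding has_signature_def by blast
  have B: "B \<subseteq> tangent_space M p" using E vector_fieldsD(1) by (auto simp: B_def)
  have "v \<in> span B"
  proof (rule ccontr)
    assume nv: "v \<notin> span B"
    then have "independent (insert v B)" using ind by (rule independent_insertI)
    moreover have "insert v B \<subseteq> span (e ` {..<r + s})" using B v e by auto
    ultimately have "card (insert v B) \<le> card (e ` {..<r + s})"
      using independent_span_bound by blast
    also have "\<dots> \<le> DIM('e)" using card_image_le[of "{..<r + s}" e] dim by simp
    finally have "card (insert v B) \<le> DIM('e)" .
    moreover have "card (insert v B) = Suc (DIM('e))"
    proof -
      have "finite B" "card B = DIM('e)" using card_image[OF inj] by (simp_all add: B_def)
      moreover have "v \<notin> B" using nv span_base[of v B] by blast
      ultimately show ?thesis by simp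
    qed
    ultimately show False by simp
  qed
  moreover have "span B \<subseteq> {X p | X. X \<in> vector_fields M}"
  proof (rule span_minimal)
    show "subspace {X p | X. X \<in> vector_fields M}"
      unfolding subspace_def
    proof (intro conjI ballI allI)
      show "0 \<in> {X p | X. X \<in> vector_fields M}" using vector_fields_zero by force
    next
      fix x y
      assume "x \<in> {X p | X. X \<in> vector_fields M}" "y \<in> {X p | X. X \<in> vector_fields M}"
      then obtain X Y where "X \<in> vector_fields M" "Y \<in> vector_fields M" "x = X p" "y = Y p" by blast
      then show "x + y \<in> {X p | X. X \<in> vector_fields M}"
        using vector_fields_add[of X Y] by (auto intro!: exI[of _ "X + Y"])
    next
      fix c x
      assume "x \<in> {X p | X. X \<in> vector_fields M}"
      then obtain X where "X \<in> vector_fields M" "x = X p" by blast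
      then show "c *\<^sub>R x \<in> {X p | X. X \<in> vector_fields M}"
        using vector_fields_scale[OF smooth_functions_const[of c], of X]
        by (auto intro!: exI[of _ "\<lambda>p. c *\<^sub>R X p"])
    qed
    show "B \<subseteq> {X p | X. X \<in> vector_fields M}" using E by (auto simp: B_def)
  qed
  ultimately show ?thesis using that by blast
qed

end

section \<open>Generalized metric connections with totally skew torsion\<close>

locale generalized_metric_connection_skew_torsion =
  weak_almost_paracontact_metric_manifold M m A Q \<eta> \<xi> g
  for M :: "('a::{t2_space,second_countable_topology}, 'e::euclidean_space) atlas"
    and m A Q \<eta> \<xi> g +
  fixes Dg D :: "'a vfield \<Rightarrow> 'a vfield \<Rightarrow> 'a vfield"
  assumes levi_civita: "levi_civita_connection M g Dg"
    and generalized_metric_connection: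
      "generalized_metric_connection M (generalized_metric A g) D"
    and torsion_skew: "totally_skew M (torsion_03 g D)"
begin

abbreviation T where "T \<equiv> torsion_03 g D"

lemma g_sym: "u \<in> tangent_space M p \<Longrightarrow> v \<in> tangent_space M p \<Longrightarrow> g p u v = g p v u"
  using metric by (simp add: pseudo_riemannian_metric_def)

lemma g_linear:
  assumes "u \<in> tangent_space M p"
  shows "linear_on (tangent_space M p) (\<lambda>v. g p u v)" "linear_on (tangent_space M p) (\<lambda>v. g p v u)"
  using metric assms by (auto simp: pseudo_riemannian_metric_def tensor_02_def)

lemma
  shows A_tangent: "u \<in> tangent_space M p \<Longrightarrow> A p u \<in> tangent_space M p"
    and A_linear: "linear_on (tangent_space M p) (A p)"
    and app_A_field: "X \<in> vector_fields M \<Longrightarrow> app A X \<in> vector_fields M"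
  using A_tensor by (auto simp: tensor_11_def app_def)

lemma
  shows Q_tangent: "u \<in> tangent_space M p \<Longrightarrow> Q p u \<in> tangent_space M p"
    and Q_linear: "linear_on (tangent_space M p) (Q p)"
    and app_Q_field: "X \<in> vector_fields M \<Longrightarrow> app Q X \<in> vector_fields M"
  using Q_tensor by (auto simp: tensor_11_def app_def)

lemma g_smooth:
  "X \<in> vector_fields M \<Longrightarrow> Y \<in> vector_fields M \<Longrightarrow> (\<lambda>p. g p (X p) (Y p)) \<in> smooth_functions M"
  using metric by (simp add: pseudo_riemannian_metric_def tensor_02_def)

lemmas field_at = vector_fieldsD(1)

text \<open>
  Every tangent vector is the value of a vector field, so pairing with vector fields tests a vector
  as well as pairing with the whole tangent space.
\<close>

lemma g_nondegenerate:
  assumes u: "u \<in> tangent_space M p" and Z: "\<And>Z. Z \<in> vector_fields M \<Longrightarrow> g p u (Z p) = 0"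
  shows "u = 0"
proof -
  have sig: "has_signature (tangent_space M p) (g p) (m + 1) m"
    using metric by (simp add: pseudo_riemannian_metric_def)
  show ?thesis
  proof (rule has_signature_nondegenerate[OF sig subspace_tangent_space g_linear(2) u])
    fix v
    assume "v \<in> tangent_space M p"
    then obtain Z where "Z \<in> vector_fields M" "Z p = v"
      using tangent_vector_extends[OF sig] dimension by auto
    then show "g p u v = 0" using Z by blast
  qed
qed

lemma field_eqI:
  assumes X: "X \<in> vector_fields M" and Y: "Y \<in> vector_fields M"
    and eq: "\<And>Z p. Z \<in> vector_fields M \<Longrightarrow> g p (X p) (Z p) = g p (Y p) (Z p)"
  shows "X = Y"
proof
  fix p
  have "X p - Y p = 0"
  proof (rule g_nondegenerate)
    show "X p - Y p \<in> tangent_space M p"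
      using X Y by (intro subspace_diff subspace_tangent_space field_at)
    show "g p (X p - Y p) (Z p) = 0" if "Z \<in> vector_fields M" for Z
      using linear_on_tangent_diff[OF g_linear(2)] field_at eq X Y that by simp
  qed
  then show "X p = Y p" by simp
qed

lemma A_skew': "u \<in> tangent_space M p \<Longrightarrow> v \<in> tangent_space M p \<Longrightarrow> g p (A p u) v = - g p (A p v) u"
  using A_skew[of u p v] g_sym[OF _ A_tangent, of u p v] by simp

lemma Q_self_adjoint:
  assumes u: "u \<in> tangent_space M p" and v: "v \<in> tangent_space M p"
  shows "g p (Q p u) v = g p u (Q p v)"
  using A_compatible[OF u v] A_compatible[OF v u] g_sym[OF A_tangent[OF u] A_tangent[OF v]]
    g_sym[OF u Q_tangent[OF v]] by (simp add: mult.commute)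

lemma
  assumes X: "X \<in> vector_fields M" and Y: "Y \<in> vector_fields M"
  shows D_field: "D X Y \<in> vector_fields M" and Dg_field: "Dg X Y \<in> vector_fields M"
    and torsion_field: "torsion D X Y \<in> vector_fields M"
proof -
  show D: "D X Y \<in> vector_fields M" "Dg X Y \<in> vector_fields M"
    using generalized_metric_connection levi_civita X Y
    by (auto simp: generalized_metric_connection_def levi_civita_connection_def
        linear_connection_def)
  have "D Y X \<in> vector_fields M"
    using generalized_metric_connection X Y
    by (auto simp: generalized_metric_connection_def linear_connection_def)
  then show "torsion D X Y \<in> vector_fields M"
    unfolding torsion_def
    using D by (intro vector_fields_diff vector_fields_lie_bracket X Y)
qed

text \<open>
  Evaluating \<open>D(g + F) = 0\<close> on \<open>(Y, Z)\<close> and on \<open>(Z, Y)\<close> gives the derivatives of the sum and the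
  difference of \<open>g(Y, Z)\<close> and \<open>F(Y, Z)\<close>; half their sum and half their difference are the two claims.
\<close>

lemma
  assumes X: "X \<in> vector_fields M" and Y: "Y \<in> vector_fields M" and Z: "Z \<in> vector_fields M"
  shows D_metric: "X p (\<lambda>q. g q (Y q) (Z q)) = g p (D X Y p) (Z p) + g p (Y p) (D X Z p)"
    and D_fundamental_form: "X p (\<lambda>q. g q (A q (Y q)) (Z q))
      = g p (A p (D X Y p)) (Z p) + g p (A p (Y p)) (D X Z p)"
proof -
  let ?s = "X p (\<lambda>q. g q (Y q) (Z q))" and ?f = "X p (\<lambda>q. g q (A q (Y q)) (Z q))"
  have par: "X p (\<lambda>q. g q (U q) (W q) + g q (A q (U q)) (W q))
      = g p (D X U p) (W p) + g p (A p (D X U p)) (W p) + g p (U p) (D X W p) + g p (A p (U p)) (D X W p)"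
    if "U \<in> vector_fields M" "W \<in> vector_fields M" for U W
  proof -
    have "cov_deriv_02 D (generalized_metric A g) X U W p = 0"
      using generalized_metric_connection X that
      unfolding generalized_metric_connection_def parallel_02_def by blast
    then show ?thesis
      by (simp add: cov_deriv_02_def generalized_metric_def fundamental_form_def)
  qed
  have smooth: "(\<lambda>q. g q (Y q) (Z q)) \<in> smooth_functions M"
    "(\<lambda>q. g q (A q (Y q)) (Z q)) \<in> smooth_functions M"
    using g_smooth[OF Y Z] g_smooth[OF app_A_field[OF Y] Z] by (auto simp: app_def)
  have plus: "?s + ?f = g p (D X Y p) (Z p) + g p (A p (D X Y p)) (Z p)
      + g p (Y p) (D X Z p) + g p (A p (Y p)) (D X Z p)"
    using par[OF Y Z] tangent_spaceD(2)[OF field_at[OF X] smooth] by simp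
  \<comment> \<open>The same function with \<open>Y\<close> and \<open>Z\<close> exchanged: the skew part changes sign.\<close>
  have "(\<lambda>q. g q (Z q) (Y q) + g q (A q (Z q)) (Y q)) = (\<lambda>q. g q (Y q) (Z q) - g q (A q (Y q)) (Z q))"
  proof
    fix q
    show "g q (Z q) (Y q) + g q (A q (Z q)) (Y q) = g q (Y q) (Z q) - g q (A q (Y q)) (Z q)"
      using g_sym[OF field_at[OF Y] field_at[OF Z], of q] A_skew'[OF field_at[OF Y] field_at[OF Z], of q]
      by simp
  qed
  then have "?s - ?f = g p (D X Z p) (Y p) + g p (A p (D X Z p)) (Y p)
      + g p (Z p) (D X Y p) + g p (A p (Z p)) (D X Y p)"
    using par[OF Z Y] tangent_diff[OF field_at[OF X] smooth] by simp
  also have "\<dots> = g p (Y p) (D X Z p) - g p (A p (Y p)) (D X Z p)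
      + g p (D X Y p) (Z p) - g p (A p (D X Y p)) (Z p)"
    using g_sym[OF field_at[OF Y] field_at[OF D_field[OF X Z]], of p]
      g_sym[OF field_at[OF Z] field_at[OF D_field[OF X Y]], of p]
      A_skew'[OF field_at[OF Y] field_at[OF D_field[OF X Z]], of p]
      A_skew'[OF field_at[OF Z] field_at[OF D_field[OF X Y]], of p]
    by simp
  finally show "?s = g p (D X Y p) (Z p) + g p (Y p) (D X Z p)"
    "?f = g p (A p (D X Y p)) (Z p) + g p (A p (Y p)) (D X Z p)"
    using plus by linarith+
qed

lemma D_A:
  assumes X: "X \<in> vector_fields M" and Y: "Y \<in> vector_fields M"
  shows "D X (app A Y) = app A (D X Y)"
proof (rule field_eqI)
  show "D X (app A Y) \<in> vector_fields M" "app A (D X Y) \<in> vector_fields M"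
    using X Y by (auto intro: D_field app_A_field)
  show "g p (D X (app A Y) p) (Z p) = g p (app A (D X Y) p) (Z p)" if Z: "Z \<in> vector_fields M" for Z p
    using D_metric[OF X app_A_field[OF Y] Z, of p] D_fundamental_form[OF X Y Z, of p]
    by (simp add: app_def)
qed

lemma Dg_metric:
  assumes "X \<in> vector_fields M" "Y \<in> vector_fields M" "Z \<in> vector_fields M"
  shows "X p (\<lambda>q. g q (Y q) (Z q)) = g p (Dg X Y p) (Z p) + g p (Y p) (Dg X Z p)"
proof -
  have "cov_deriv_02 Dg g X Y Z p = 0"
    using levi_civita assms unfolding levi_civita_connection_def parallel_02_def by blast
  then show ?thesis by (simp add: cov_deriv_02_def)
qed

lemma
  assumes "X \<in> vector_fields M" "Y \<in> vector_fields M" "Z \<in> vector_fields M"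
  shows T_skew12: "T Y X Z p = - T X Y Z p" and T_skew23: "T X Z Y p = - T X Y Z p"
  using torsion_skew[unfolded totally_skew_def, rule_format, OF assms, of p] by simp_all

text \<open>
  The difference \<open>S = g(D - Dg, _)\<close> is skew in its last two arguments, since both connections are
  metric, and its antisymmetrization in the first two is \<open>T\<close>, since \<open>Dg\<close> has no torsion. Three
  cyclic instances give \<open>2 S(X, Y, Z) = T(X, Y, Z) - T(Y, Z, X) + T(Z, X, Y)\<close>, as for the Koszul
  formula, and the last two terms cancel for a 3-form.
\<close>

lemma D_eq_Dg_plus_half_torsion:
  assumes X: "X \<in> vector_fields M" and Y: "Y \<in> vector_fields M" and Z: "Z \<in> vector_fields M"
  shows "g p (D X Y p) (Z p) = g p (Dg X Y p) (Z p) + T X Y Z p / 2"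
proof -
  define S where "S X Y Z = g p (D X Y p) (Z p) - g p (Dg X Y p) (Z p)" for X Y Z
  have skew: "S X Y Z = - S X Z Y"
    if X: "X \<in> vector_fields M" and Y: "Y \<in> vector_fields M" and Z: "Z \<in> vector_fields M" for X Y Z
    using D_metric[OF X Y Z, of p] Dg_metric[OF X Y Z, of p]
      g_sym[OF field_at[OF Y] field_at[OF D_field[OF X Z]], of p]
      g_sym[OF field_at[OF Y] field_at[OF Dg_field[OF X Z]], of p]
    by (simp add: S_def)
  have alt: "S X Y Z - S Y X Z = T X Y Z p"
    if X: "X \<in> vector_fields M" and Y: "Y \<in> vector_fields M" and Z: "Z \<in> vector_fields M" for X Y Z
  proof -
    note lin = linear_on_tangent_diff[OF g_linear(2)[OF field_at[OF Z]]]
    have "torsion Dg X Y = 0"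
      using levi_civita X Y unfolding levi_civita_connection_def by blast
    then have "torsion Dg X Y p = 0" by simp
    then have "lie_bracket X Y p = Dg X Y p - Dg Y X p" by (simp add: torsion_def)
    then have "torsion D X Y p = (D X Y p - D Y X p) - (Dg X Y p - Dg Y X p)"
      by (simp add: torsion_def)
    then have "T X Y Z p = g p ((D X Y p - D Y X p) - (Dg X Y p - Dg Y X p)) (Z p)"
      by (simp add: torsion_03_def)
    also have "\<dots> = S X Y Z - S Y X Z"
      using X Y by (simp add: lin S_def subspace_diff[OF subspace_tangent_space] field_at D_field Dg_field)
    finally show ?thesis by simp
  qed
  have "2 * S X Y Z = T X Y Z p - T Y Z X p + T Z X Y p"
    using alt[OF X Y Z] alt[OF Y Z X] alt[OF Z X Y] skew[OF X Y Z] skew[OF Y Z X] skew[OF Z X Y]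
    by linarith
  also have "\<dots> = T X Y Z p"
    using T_skew12[OF X Z Y, of p] T_skew12[OF Y Z X, of p] T_skew23[OF X Y Z, of p]
      T_skew12[OF X Y Z, of p] T_skew23[OF Y X Z, of p] by linarith
  finally show ?thesis by (simp add: S_def)
qed

text \<open>
  \<open>D\<^sub>X\<xi>\<close> lies in the kernel of \<open>A\<close>, as \<open>A\<xi> = 0\<close> and \<open>A\<close> is parallel, and in the kernel of \<open>\<eta>\<close>, as \<open>\<xi>\<close>
  has constant length. These kernels meet only in zero, because \<open>Q = A\<^sup>2 + \<eta> \<otimes> \<xi>\<close> is injective.
\<close>

lemma D_xi:
  assumes X: "X \<in> vector_fields M"
  shows "D X \<xi> p = 0"
proof -
  let ?w = "D X \<xi> p"
  have w: "?w \<in> tangent_space M p" using field_at D_field X \<xi>_field by blast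
  have zero: "(0 :: 'a vfield) \<in> vector_fields M"
    using vector_fields_zero by (simp add: zero_fun_def)
  \<comment> \<open>Parallelism of \<open>A\<close> is applied to \<open>app A \<xi> = 0\<close>, so \<open>D\<close> must annihilate the zero field.\<close>
  have "D X (0 + 0) = D X 0 + D X 0"
    using generalized_metric_connection X zero
    unfolding generalized_metric_connection_def linear_connection_def by blast
  then have "D X 0 = 0" by simp
  moreover have "app A \<xi> = 0" using A_\<xi> by (simp add: app_def fun_eq_iff)
  ultimately have Aw: "A p ?w = 0" using D_A[OF X \<xi>_field] by (metis app_def zero_fun_apply)
  have one: "g q (\<xi> q) (\<xi> q) = 1" for q using \<eta>_dual[OF field_at[OF \<xi>_field]] \<eta>_\<xi> by metis
  have "\<eta> p ?w = 0"
    using D_metric[OF X \<xi>_field \<xi>_field, of p] g_sym[OF w field_at[OF \<xi>_field]] \<eta>_dual[OF w]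
    by (simp add: one tangent_const[OF field_at[OF X]])
  then have "Q p ?w = 0"
    using A_square[OF w] Aw linear_on_tangent_0[OF A_linear] by simp
  then show ?thesis
    using Q_nonsingular[of p] w linear_on_tangent_0[OF Q_linear, of p]
      subspace_0[OF subspace_tangent_space, of p]
    unfolding bij_betw_def by (metis inj_onD)
qed

lemma Dg_xi:
  assumes X: "X \<in> vector_fields M" and Y: "Y \<in> vector_fields M"
  shows "g p (Dg X \<xi> p) (Y p) = T X Y \<xi> p / 2"
  using D_eq_Dg_plus_half_torsion[OF X \<xi>_field Y, of p] D_xi[OF X, of p]
    linear_on_tangent_0[OF g_linear(2)[OF field_at[OF Y, of p]]] T_skew23[OF X Y \<xi>_field, of p]
  by simp

lemma xi_killing: "killing_field M g Dg \<xi>"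
  unfolding killing_field_def
proof (intro ballI allI)
  fix X Y p
  assume X: "X \<in> vector_fields M" and Y: "Y \<in> vector_fields M"
  show "g p (Dg X \<xi> p) (Y p) + g p (Dg Y \<xi> p) (X p) = 0"
    using Dg_xi[OF X Y, of p] Dg_xi[OF Y X, of p] T_skew12[OF X Y \<xi>_field, of p] by simp
qed

lemma xi_geodesic: "geodesic_field Dg \<xi>"
  unfolding geodesic_field_def
proof (rule field_eqI)
  show "Dg \<xi> \<xi> \<in> vector_fields M" by (intro Dg_field \<xi>_field)
  show "0 \<in> vector_fields M" using vector_fields_zero by (simp add: zero_fun_def)
  show "g p (Dg \<xi> \<xi> p) (Z p) = g p (0 p) (Z p)" if Z: "Z \<in> vector_fields M" for Z p
    using Dg_xi[OF \<xi>_field Z, of p] T_skew23[OF \<xi>_field \<xi>_field Z, of p]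
      T_skew12[OF \<xi>_field \<xi>_field Z, of p] linear_on_tangent_0[OF g_linear(2)[OF field_at[OF Z, of p]]]
    by simp
qed

section \<open>The Nijenhuis tensor in terms of the torsion\<close>

text \<open>
  By metricity \<open>(\<nabla>\<^sup>g\<^sub>X\<eta>)(Y) = g(Y, \<nabla>\<^sup>g\<^sub>X\<xi>) = T(X, Y, \<xi>) / 2\<close>, and antisymmetrization doubles it.
\<close>

lemma ext_deriv_eta:
  assumes X: "X \<in> vector_fields M" and Y: "Y \<in> vector_fields M"
  shows "ext_deriv Dg \<eta> X Y p = T X Y \<xi> p"
proof -
  have cov: "cov_deriv_form Dg \<eta> X Y p = T X Y \<xi> p / 2"
    if X: "X \<in> vector_fields M" and Y: "Y \<in> vector_fields M" for X Y
  proof -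
    have "X p (\<lambda>q. \<eta> q (Y q)) = X p (\<lambda>q. g q (Y q) (\<xi> q))"
      by (simp add: \<eta>_dual field_at Y)
    then show ?thesis
      unfolding cov_deriv_form_def
      using Dg_metric[OF X Y \<xi>_field, of p] \<eta>_dual[OF field_at[OF Dg_field[OF X Y]]]
        g_sym[OF field_at[OF Y] field_at[OF Dg_field[OF X \<xi>_field]], of p] Dg_xi[OF X Y, of p]
      by simp
  qed
  show ?thesis
    unfolding ext_deriv_def using cov[OF X Y] cov[OF Y X] T_skew12[OF X Y \<xi>_field, of p] by simp
qed

text \<open>
  After rewriting the brackets with \<open>D\<close> and moving \<open>A\<close> out of the derivatives, the terms
  \<open>A D\<^bsub>AX\<^esub>Y\<close>, \<open>A D\<^bsub>AY\<^esub>X\<close>, \<open>A\<^sup>2 D\<^sub>XY\<close> and \<open>A\<^sup>2 D\<^sub>YX\<close> each occur twice with opposite signs.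
\<close>

lemma nijenhuis_torsion:
  assumes X: "X \<in> vector_fields M" and Y: "Y \<in> vector_fields M"
  shows "nijenhuis A X Y p = A p (torsion D (app A X) Y p) + A p (torsion D X (app A Y) p)
    - torsion D (app A X) (app A Y) p - A p (A p (torsion D X Y p))"
proof -
  note AX = app_A_field[OF X] and AY = app_A_field[OF Y]
  note lin = linear_on_tangent_diff[OF A_linear]
  have bracket: "lie_bracket U W p = D U W p - D W U p - torsion D U W p" for U W
    by (simp add: torsion_def)
  have DA: "D U (app A W) p = A p (D U W p)"
    if "U \<in> vector_fields M" "W \<in> vector_fields M" for U W
    using D_A[OF that] by (simp add: app_def)
  have app: "app A U q = A q (U q)" for U q by (simp add: app_def)
  show ?thesis
    using X Y AX AY
    by (simp add: nijenhuis_def bracket DA lin subspace_diff[OF subspace_tangent_space]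
        field_at D_field torsion_field A_tangent app)
qed

text \<open>
  Lowering the index and moving \<open>A\<close> to the last argument leaves \<open>- T(X, Y, A\<^sup>2Z)\<close>, that is,
  \<open>- T(X, Y, QZ) + \<eta>(Z) T(X, Y, \<xi>)\<close>. Its second term is \<open>d\<eta>(X, Y) \<eta>(Z)\<close>, so the correction in the
  weak almost para-contact Nijenhuis tensor removes just that.
\<close>

lemma nijenhuis_wapc_torsion:
  assumes X: "X \<in> vector_fields M" and Y: "Y \<in> vector_fields M" and Z: "Z \<in> vector_fields M"
  shows "nijenhuis_wapc A \<eta> g Dg X Y Z p =
    - (T (app A X) (app A Y) Z p + T (app A X) Y (app A Z) p + T X (app A Y) (app A Z) p)
    - T X Y (app Q Z) p"
proof -
  note AX = app_A_field[OF X] and AY = app_A_field[OF Y]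
  note Zp = field_at[OF Z, of p]
  note t = field_at[OF torsion_field[OF X Y], of p]
  have AA: "g p (A p (A p (torsion D X Y p))) (Z p)
      = T X Y (app Q Z) p - \<eta> p (Z p) * T X Y \<xi> p"
  proof -
    have "g p (A p (A p (torsion D X Y p))) (Z p) = g p (torsion D X Y p) (A p (A p (Z p)))"
      using A_skew[OF A_tangent[OF t] Zp] A_skew[OF t A_tangent[OF Zp]] by simp
    also have "\<dots> = g p (torsion D X Y p) (Q p (Z p) - \<eta> p (Z p) *\<^sub>R \<xi> p)"
      using A_square[OF Zp] by simp
    also have "\<dots> = T X Y (app Q Z) p - \<eta> p (Z p) * T X Y \<xi> p"
      using Zp field_at[OF \<xi>_field, of p]
      by (simp add: linear_on_tangent_diff[OF g_linear(1)[OF t]]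
          linear_on_tangent_scale[OF g_linear(1)[OF t]] Q_tangent
          subspace_scale[OF subspace_tangent_space] torsion_03_def app_def)
    finally show ?thesis .
  qed
  have "g p (nijenhuis A X Y p) (Z p) = - T (app A X) Y (app A Z) p - T X (app A Y) (app A Z) p
      - T (app A X) (app A Y) Z p - g p (A p (A p (torsion D X Y p))) (Z p)"
    using X Y AX AY Zp
    by (simp add: nijenhuis_torsion linear_on_tangent_diff[OF g_linear(2)[OF Zp]]
        linear_on_tangent_add[OF g_linear(2)[OF Zp]] A_tangent field_at torsion_field
        subspace_diff[OF subspace_tangent_space] subspace_add[OF subspace_tangent_space]
        A_skew[of "torsion D _ _ p"] torsion_03_def app_def[of A Z])
  then show ?thesis
    using AA by (simp add: nijenhuis_wapc_def ext_deriv_eta[OF X Y])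
qed

text \<open>
  The terms with two arguments under \<open>A\<close> form a totally skew tensor: a transposition of the
  arguments changes the sign of one of them and exchanges the other two up to sign.
\<close>

lemma nijenhuis_wapc_skew_iff:
  "totally_skew M (nijenhuis_wapc A \<eta> g Dg) \<longleftrightarrow> totally_skew M (\<lambda>X Y Z. T X Y (app Q Z))"
proof -
  let ?B = "\<lambda>X Y Z p. T (app A X) (app A Y) Z p + T (app A X) Y (app A Z) p
    + T X (app A Y) (app A Z) p"
  have B: "?B Y X Z p = - ?B X Y Z p" "?B X Z Y p = - ?B X Y Z p"
    if X: "X \<in> vector_fields M" and Y: "Y \<in> vector_fields M" and Z: "Z \<in> vector_fields M"
    for X Y Z p
    using T_skew12[OF app_A_field[OF X] app_A_field[OF Y] Z, of p]
      T_skew12[OF app_A_field[OF X] Y app_A_field[OF Z], of p]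
      T_skew12[OF X app_A_field[OF Y] app_A_field[OF Z], of p]
      T_skew23[OF app_A_field[OF X] app_A_field[OF Y] Z, of p]
      T_skew23[OF app_A_field[OF X] Y app_A_field[OF Z], of p]
      T_skew23[OF X app_A_field[OF Y] app_A_field[OF Z], of p]
    by linarith+
  have "nijenhuis_wapc A \<eta> g Dg Y X Z p = - nijenhuis_wapc A \<eta> g Dg X Y Z p \<longleftrightarrow>
      T Y X (app Q Z) p = - T X Y (app Q Z) p"
    "nijenhuis_wapc A \<eta> g Dg X Z Y p = - nijenhuis_wapc A \<eta> g Dg X Y Z p \<longleftrightarrow>
      T X Z (app Q Y) p = - T X Y (app Q Z) p"
    if "X \<in> vector_fields M" "Y \<in> vector_fields M" "Z \<in> vector_fields M" for X Y Z p
    using B[OF that, of p] that by (simp_all add: nijenhuis_wapc_torsion) linarith+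
  then show ?thesis unfolding totally_skew_def by simp
qed

text \<open>
  \<open>T(X, Y, QZ)\<close> is always skew in \<open>X\<close> and \<open>Y\<close>. Skewness in \<open>Y\<close> and \<open>Z\<close> lets \<open>Q\<close> move between the second
  and third arguments of the 3-form \<open>T\<close>, hence, with the first symmetry, to any argument;
  self-adjointness turns \<open>Q\<close> on the third argument into \<open>Q T(X, Y)\<close>.
\<close>

lemma Q_torsion_iff:
  "Q_torsion_condition M Q D \<longleftrightarrow> totally_skew M (\<lambda>X Y Z. T X Y (app Q Z))"
proof
  have adj: "T X Y (app Q Z) p = g p (Q p (torsion D X Y p)) (Z p)"
    if "X \<in> vector_fields M" "Y \<in> vector_fields M" "Z \<in> vector_fields M" for X Y Z p
    using Q_self_adjoint field_at torsion_field that by (simp add: torsion_03_def app_def)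
  {
    assume Q: "Q_torsion_condition M Q D"
    show "totally_skew M (\<lambda>X Y Z. T X Y (app Q Z))"
      unfolding totally_skew_def
    proof (intro ballI allI conjI)
      fix X Y Z p
      assume X: "X \<in> vector_fields M" and Y: "Y \<in> vector_fields M" and Z: "Z \<in> vector_fields M"
      show "T Y X (app Q Z) p = - T X Y (app Q Z) p"
        by (rule T_skew12[OF X Y app_Q_field[OF Z]])
      have "torsion D X (app Q Y) = app Q (torsion D X Y)"
        using Q X Y unfolding Q_torsion_condition_def by blast
      then have "T X (app Q Y) Z p = T X Y (app Q Z) p"
        using adj[OF X Y Z] by (simp add: torsion_03_def app_def)
      then show "T X Z (app Q Y) p = - T X Y (app Q Z) p"
        using T_skew23[OF X app_Q_field[OF Y] Z, of p] by simp
    qed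
  }
  {
    assume S: "totally_skew M (\<lambda>X Y Z. T X Y (app Q Z))"
    have second: "T X (app Q Y) Z p = T X Y (app Q Z) p"
      if X: "X \<in> vector_fields M" and Y: "Y \<in> vector_fields M" and Z: "Z \<in> vector_fields M"
      for X Y Z p
    proof -
      have "T X Z (app Q Y) p = - T X Y (app Q Z) p"
        using S X Y Z unfolding totally_skew_def by blast
      then show ?thesis using T_skew23[OF X Z app_Q_field[OF Y], of p] by simp
    qed
    have first: "T (app Q X) Y Z p = T X Y (app Q Z) p"
      if X: "X \<in> vector_fields M" and Y: "Y \<in> vector_fields M" and Z: "Z \<in> vector_fields M"
      for X Y Z p
      using second[OF Y X Z, of p] T_skew12[OF Y app_Q_field[OF X] Z, of p]
        T_skew12[OF X Y app_Q_field[OF Z], of p] by simp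
    show "Q_torsion_condition M Q D"
      unfolding Q_torsion_condition_def
    proof (intro ballI conjI)
      fix X Y
      assume X: "X \<in> vector_fields M" and Y: "Y \<in> vector_fields M"
      show "torsion D (app Q X) Y = torsion D X (app Q Y)"
      proof (rule field_eqI)
        show "torsion D (app Q X) Y \<in> vector_fields M" "torsion D X (app Q Y) \<in> vector_fields M"
          using X Y by (auto intro: torsion_field app_Q_field)
        show "g p (torsion D (app Q X) Y p) (Z p) = g p (torsion D X (app Q Y) p) (Z p)"
          if Z: "Z \<in> vector_fields M" for Z p
          using first[OF X Y Z, of p] second[OF X Y Z, of p] by (simp add: torsion_03_def)
      qed
      show "torsion D X (app Q Y) = app Q (torsion D X Y)"
      proof (rule field_eqI)
        show "torsion D X (app Q Y) \<in> vector_fields M" "app Q (torsion D X Y) \<in> vector_fields M"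
          using X Y by (auto intro: torsion_field app_Q_field)
        show "g p (torsion D X (app Q Y) p) (Z p) = g p (app Q (torsion D X Y) p) (Z p)"
          if Z: "Z \<in> vector_fields M" for Z p
          using second[OF X Y Z, of p] adj[OF X Y Z, of p] by (simp add: torsion_03_def app_def)
      qed
    qed
  }
qed

end

section \<open>Killing Reeb field and the torsion condition\<close>

theorem theorem3p14:
  fixes M :: "('a::{t2_space,second_countable_topology}, 'e::euclidean_space) atlas"
    and m :: nat
    and A Q :: "'a \<Rightarrow> 'a tangent \<Rightarrow> 'a tangent"
    and \<eta> :: "'a \<Rightarrow> 'a tangent \<Rightarrow> real"
    and \<xi> :: "'a vfield"
    and g :: "'a \<Rightarrow> 'a tangent \<Rightarrow> 'a tangent \<Rightarrow> real"
    and Dg D :: "'a vfield \<Rightarrow> 'a vfield \<Rightarrow> 'a vfield"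
  assumes "weak_almost_paracontact_metric_manifold M m A Q \<eta> \<xi> g"
    and "levi_civita_connection M g Dg"
    and "generalized_metric_connection M (generalized_metric A g) D"
    and "totally_skew M (torsion_03 g D)"
  shows "(geodesic_field Dg \<xi> \<and> killing_field M g Dg \<xi>) \<and>
    (Q_torsion_condition M Q D \<longleftrightarrow> totally_skew M (nijenhuis_wapc A \<eta> g Dg))"
proof -
  interpret generalized_metric_connection_skew_torsion M m A Q \<eta> \<xi> g Dg D
    using assms by (intro generalized_metric_connection_skew_torsion.intro
        generalized_metric_connection_skew_torsion_axioms.intro)
  show ?thesis
    using xi_geodesic xi_killing Q_torsion_iff nijenhuis_wapc_skew_iff by blast
qed

end
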